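(* Let $(M,K)$ be a Cartan space, let $v:[0,\infty)\to\mathbb{R}$ be smooth and let $\alpha,\beta$ be real constants with $\alpha,\beta>0$ and $\alpha+2\tau v(\tau)>0$ on $T^{*}M_0$, where $\tau=\frac12K^2$. Let $G$ be the Riemannian metric $G=G_{ij}dx^idx^j+G^{ij}\delta p_i\delta p_j$ on $T^{*}M_0$, with $G_{ij}=\frac1\beta g_{ij}+\frac{v(\tau)}{\alpha\beta}p_ip_j$ and $(G^{ij})=(G_{ij})^{-1}$, and let $J$ be the almost complex structure on $T^{*}M_0$ given by $J(\delta_i)=G_{ik}\dot\partial^k$, $J(\dot\partial^i)=-G^{ik}\delta_k$. Then $(T^{*}M_0,G,J)$ is an almost Kählerian manifold, i.e. $G(JX,JY)=G(X,Y)$ for all vector fields $X,Y$ on $T^{*}M_0$, and the fundamental 2-form $\theta(X,Y)=G(X,JY)$ is closed.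
   Context: $M$ is a smooth $n$-dimensional manifold, $T^{*}M_0$ is its cotangent bundle with the zero section removed, $(x^i,p_i)$ are the induced local coordinates, $\partial_i=\partial/\partial x^i$, $\dot\partial^i=\partial/\partial p_i$; the summation convention is used. A Cartan space $(M,K)$ is a manifold $M$ with a function $K:T^{*}M\to[0,\infty)$ that is $C^\infty$ on $T^{*}M_0$, satisfies $K(x,\lambda p)=\lambda K(x,p)$ for $\lambda>0$, and for which $g^{ij}(x,p)=\frac12\dot\partial^i\dot\partial^jK^2$ is positive definite on $T^{*}M_0$. Let $(g_{ij})=(g^{ij})^{-1}$ and $p^i=g^{ij}p_j=\frac12\dot\partial^iK^2$, so $K^2=g^{ij}p_ip_j$. Nonlinear connection: with $\gamma^i_{jk}=\frac12g^{is}(\partial_kg_{js}+\partial_jg_{sk}-\partial_sg_{jk})$, $\gamma^\circ_{jk}=\gamma^i_{jk}p_i$ and $\gamma^\circ_{j\circ}=\gamma^i_{jk}p_ip^k$, put $N_{ij}=\gamma^\circ_{ij}-\frac12\gamma^\circ_{h\circ}\dot\partial^hg_{ij}$ (symmetric in $i,j$). Then $\delta_i=\partial_i+N_{ij}\dot\partial^j$ and $\dot\partial^i$ form a local frame of $T(T^{*}M_0)$ with dual coframe $dx^i$, $\delta p_i=dp_i-N_{ji}dx^j$. The inverse of $(G_{ij})$ is $G^{kl}=\beta g^{kl}-\frac{v\beta}{\alpha+2\tau v}p^kp^l$; the conditions $\alpha,\beta>0$, $\alpha+2\tau v>0$ are those making $(G_{ij})$ positive definite. *)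

theory Defs
  imports "HOL-Analysis.Analysis"
begin

text \<open>Smooth maps. For an open subset of a finite-dimensional space, \<open>Ck_on k S f\<close> says that
  \<open>f\<close> is of class \<open>C\<^sup>k\<close> on \<open>S\<close>; it is only used for such sets.\<close>

fun Ck_on :: "nat \<Rightarrow> 'a::real_normed_vector set \<Rightarrow> ('a \<Rightarrow> 'b::real_normed_vector) \<Rightarrow> bool" where
  "Ck_on 0 S f \<longleftrightarrow> continuous_on S f"
| "Ck_on (Suc k) S f \<longleftrightarrow>
     (\<forall>x\<in>S. f differentiable (at x)) \<and> (\<forall>h. Ck_on k S (\<lambda>x. frechet_derivative f (at x) h))"

definition smooth_on :: "'a::real_normed_vector set \<Rightarrow> ('a \<Rightarrow> 'b::real_normed_vector) \<Rightarrow> bool" where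
  "smooth_on S f \<longleftrightarrow> (\<forall>k. Ck_on k S f)"

text \<open>Smoothness on the half-line \<open>[0,\<infinity>)\<close>, with one-sided derivatives at \<open>0\<close>; the values of
  \<open>v\<close> on negative arguments play no role.\<close>

definition smooth_halfline :: "(real \<Rightarrow> real) \<Rightarrow> bool" where
  "smooth_halfline v \<longleftrightarrow>
     (\<exists>D :: nat \<Rightarrow> real \<Rightarrow> real. D 0 = v \<and>
        (\<forall>k. \<forall>t\<ge>0. (D k has_real_derivative D (Suc k) t) (at t within {0..})))"


section \<open>Manifolds, tangent vectors and tensor fields\<close>

text \<open>A chart is a pair (domain, coordinate map). Only the values of the coordinate map on the
  domain matter.\<close>

type_synonym ('m, 'e) chart = "'m set \<times> ('m \<Rightarrow> 'e)"

definition chart_image :: "('m, 'e) chart \<Rightarrow> 'e set" where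
  "chart_image c = snd c ` fst c"

definition chart_inv :: "('m, 'e) chart \<Rightarrow> 'e \<Rightarrow> 'm" where
  "chart_inv c = inv_into (fst c) (snd c)"

definition transition :: "('m, 'e) chart \<Rightarrow> ('m, 'e) chart \<Rightarrow> 'e \<Rightarrow> 'e" where
  "transition c c' = snd c' \<circ> chart_inv c"

text \<open>A smooth structure on the Hausdorff, second countable space \<open>'m\<close>, given by an arbitrary
  (not necessarily maximal) smooth atlas.\<close>

definition smooth_atlas ::
    "('m::{t2_space, second_countable_topology}, 'e::euclidean_space) chart set \<Rightarrow> bool" where
  "smooth_atlas A \<longleftrightarrow>
     (\<Union>c\<in>A. fst c) = UNIV \<and>
     (\<forall>c\<in>A. open (fst c) \<and> open (chart_image c) \<and>
            homeomorphism (fst c) (chart_image c) (snd c) (chart_inv c)) \<and>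
     (\<forall>c\<in>A. \<forall>c'\<in>A. smooth_on (snd c ` (fst c \<inter> fst c')) (transition c c'))"

text \<open>The following notions refer to a manifold only through the charts of an atlas, so that
  they apply both to the base manifold and to its slit cotangent bundle, whose points form a set
  and not a type.\<close>

definition atlas_carrier :: "('m, 'e) chart set \<Rightarrow> 'm set" where
  "atlas_carrier A = (\<Union>c\<in>A. fst c)"

definition charts_at :: "('m, 'e) chart set \<Rightarrow> 'm \<Rightarrow> ('m, 'e) chart set" where
  "charts_at A u = {c \<in> A. u \<in> fst c}"

definition smooth_function ::
    "('m, 'e::euclidean_space) chart set \<Rightarrow> ('m \<Rightarrow> real) \<Rightarrow> bool" where
  "smooth_function A f \<longleftrightarrow> (\<forall>c\<in>A. smooth_on (chart_image c) (f \<circ> chart_inv c))"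

text \<open>A tangent vector at \<open>u\<close> is the family of its coordinate vectors in all charts around \<open>u\<close>,
  related by the Jacobians of the coordinate changes (and normalised to \<open>0\<close> on all other
  charts).\<close>

definition tangent_space ::
    "('m, 'e::euclidean_space) chart set \<Rightarrow> 'm \<Rightarrow> (('m, 'e) chart \<Rightarrow> 'e) set" where
  "tangent_space A u = {X.
     (\<forall>c\<in>charts_at A u. \<forall>c'\<in>charts_at A u.
        X c' = frechet_derivative (transition c c') (at (snd c u)) (X c)) \<and>
     (\<forall>c. c \<notin> charts_at A u \<longrightarrow> X c = 0)}"

text \<open>The tangent vector at \<open>u\<close> whose coordinate vector in the chart \<open>c\<close> is \<open>e\<close>.\<close>

definition coord_vec ::
    "('m, 'e::euclidean_space) chart set \<Rightarrow> ('m, 'e) chart \<Rightarrow> 'm \<Rightarrow> 'e \<Rightarrow> (('m, 'e) chart \<Rightarrow> 'e)"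
  where
  "coord_vec A c u e = (\<lambda>c'. if c' \<in> charts_at A u
     then frechet_derivative (transition c c') (at (snd c u)) e else 0)"

text \<open>Covectors likewise, with the contragredient transformation law
  \<open>p\<^sub>i = (\<partial>x'\<^sup>j/\<partial>x\<^sup>i) p'\<^sub>j\<close>.\<close>

definition cotangent_space ::
    "('m, 'e::euclidean_space) chart set \<Rightarrow> 'm \<Rightarrow> (('m, 'e) chart \<Rightarrow> 'e) set" where
  "cotangent_space A u = {p.
     (\<forall>c\<in>charts_at A u. \<forall>c'\<in>charts_at A u. \<forall>e.
        p c \<bullet> e = p c' \<bullet> frechet_derivative (transition c c') (at (snd c u)) e) \<and>
     (\<forall>c. c \<notin> charts_at A u \<longrightarrow> p c = 0)}"

definition vector_field ::
    "('m, 'e::euclidean_space) chart set \<Rightarrow> ('m \<Rightarrow> (('m, 'e) chart \<Rightarrow> 'e)) \<Rightarrow> bool" where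
  "vector_field A X \<longleftrightarrow>
     (\<forall>u\<in>atlas_carrier A. X u \<in> tangent_space A u) \<and>
     (\<forall>c\<in>A. smooth_on (chart_image c) (\<lambda>z. X (chart_inv c z) c))"

text \<open>Smooth tensor fields of type (0,2) and (1,1).\<close>

definition bilinear_field ::
    "('m, 'e::euclidean_space) chart set \<Rightarrow>
     ('m \<Rightarrow> (('m, 'e) chart \<Rightarrow> 'e) \<Rightarrow> (('m, 'e) chart \<Rightarrow> 'e) \<Rightarrow> real) \<Rightarrow> bool" where
  "bilinear_field A B \<longleftrightarrow>
     (\<forall>u\<in>atlas_carrier A. \<forall>X\<in>tangent_space A u. \<forall>Y\<in>tangent_space A u. \<forall>Z\<in>tangent_space A u. \<forall>a.
        B u (\<lambda>c. a *\<^sub>R X c + Y c) Z = a * B u X Z + B u Y Z \<and>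
        B u Z (\<lambda>c. a *\<^sub>R X c + Y c) = a * B u Z X + B u Z Y) \<and>
     (\<forall>c\<in>A. \<forall>a b. smooth_on (chart_image c)
        (\<lambda>z. B (chart_inv c z) (coord_vec A c (chart_inv c z) a) (coord_vec A c (chart_inv c z) b)))"

definition endomorphism_field ::
    "('m, 'e::euclidean_space) chart set \<Rightarrow>
     ('m \<Rightarrow> (('m, 'e) chart \<Rightarrow> 'e) \<Rightarrow> (('m, 'e) chart \<Rightarrow> 'e)) \<Rightarrow> bool" where
  "endomorphism_field A J \<longleftrightarrow>
     (\<forall>u\<in>atlas_carrier A. \<forall>X\<in>tangent_space A u. J u X \<in> tangent_space A u) \<and>
     (\<forall>u\<in>atlas_carrier A. \<forall>X\<in>tangent_space A u. \<forall>Y\<in>tangent_space A u. \<forall>a.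
        J u (\<lambda>c. a *\<^sub>R X c + Y c) = (\<lambda>c. a *\<^sub>R J u X c + J u Y c)) \<and>
     (\<forall>c\<in>A. \<forall>a. smooth_on (chart_image c)
        (\<lambda>z. J (chart_inv c z) (coord_vec A c (chart_inv c z) a) c))"

definition riemannian_metric ::
    "('m, 'e::euclidean_space) chart set \<Rightarrow>
     ('m \<Rightarrow> (('m, 'e) chart \<Rightarrow> 'e) \<Rightarrow> (('m, 'e) chart \<Rightarrow> 'e) \<Rightarrow> real) \<Rightarrow> bool" where
  "riemannian_metric A G \<longleftrightarrow> bilinear_field A G \<and>
     (\<forall>u\<in>atlas_carrier A. \<forall>X\<in>tangent_space A u. \<forall>Y\<in>tangent_space A u. G u X Y = G u Y X) \<and>
     (\<forall>u\<in>atlas_carrier A. \<forall>X\<in>tangent_space A u. X \<noteq> (\<lambda>c. 0) \<longrightarrow> G u X X > 0)"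

definition almost_complex_structure ::
    "('m, 'e::euclidean_space) chart set \<Rightarrow>
     ('m \<Rightarrow> (('m, 'e) chart \<Rightarrow> 'e) \<Rightarrow> (('m, 'e) chart \<Rightarrow> 'e)) \<Rightarrow> bool" where
  "almost_complex_structure A J \<longleftrightarrow> endomorphism_field A J \<and>
     (\<forall>u\<in>atlas_carrier A. \<forall>X\<in>tangent_space A u. J u (J u X) = (\<lambda>c. - X c))"

definition two_form ::
    "('m, 'e::euclidean_space) chart set \<Rightarrow>
     ('m \<Rightarrow> (('m, 'e) chart \<Rightarrow> 'e) \<Rightarrow> (('m, 'e) chart \<Rightarrow> 'e) \<Rightarrow> real) \<Rightarrow> bool" where
  "two_form A \<theta> \<longleftrightarrow> bilinear_field A \<theta> \<and>
     (\<forall>u\<in>atlas_carrier A. \<forall>X\<in>tangent_space A u. \<theta> u X X = 0)"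

text \<open>The coordinate expression of a 2-form in the chart \<open>c\<close>, and that of its exterior derivative
  \<open>(d\<theta>)\<^sub>z(a,b,d) = D\<^sub>a \<theta>(b,d) - D\<^sub>b \<theta>(a,d) + D\<^sub>d \<theta>(a,b)\<close> on constant vectors.\<close>

definition form_in_chart ::
    "('m, 'e::euclidean_space) chart set \<Rightarrow>
     ('m \<Rightarrow> (('m, 'e) chart \<Rightarrow> 'e) \<Rightarrow> (('m, 'e) chart \<Rightarrow> 'e) \<Rightarrow> real) \<Rightarrow>
     ('m, 'e) chart \<Rightarrow> 'e \<Rightarrow> 'e \<Rightarrow> 'e \<Rightarrow> real" where
  "form_in_chart A \<theta> c a b z =
     \<theta> (chart_inv c z) (coord_vec A c (chart_inv c z) a) (coord_vec A c (chart_inv c z) b)"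

definition exterior_derivative ::
    "('m, 'e::euclidean_space) chart set \<Rightarrow>
     ('m \<Rightarrow> (('m, 'e) chart \<Rightarrow> 'e) \<Rightarrow> (('m, 'e) chart \<Rightarrow> 'e) \<Rightarrow> real) \<Rightarrow>
     ('m, 'e) chart \<Rightarrow> 'e \<Rightarrow> 'e \<Rightarrow> 'e \<Rightarrow> 'e \<Rightarrow> real" where
  "exterior_derivative A \<theta> c z a b d =
     frechet_derivative (form_in_chart A \<theta> c b d) (at z) a
     - frechet_derivative (form_in_chart A \<theta> c a d) (at z) b
     + frechet_derivative (form_in_chart A \<theta> c a b) (at z) d"

definition closed_two_form ::
    "('m, 'e::euclidean_space) chart set \<Rightarrow>
     ('m \<Rightarrow> (('m, 'e) chart \<Rightarrow> 'e) \<Rightarrow> (('m, 'e) chart \<Rightarrow> 'e) \<Rightarrow> real) \<Rightarrow> bool" where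
  "closed_two_form A \<theta> \<longleftrightarrow> two_form A \<theta> \<and>
     (\<forall>c\<in>A. \<forall>z\<in>chart_image c. \<forall>a b d. exterior_derivative A \<theta> c z a b d = 0)"

definition fundamental_form ::
    "('m \<Rightarrow> (('m, 'e) chart \<Rightarrow> 'e) \<Rightarrow> (('m, 'e) chart \<Rightarrow> 'e) \<Rightarrow> real) \<Rightarrow>
     ('m \<Rightarrow> (('m, 'e) chart \<Rightarrow> 'e) \<Rightarrow> (('m, 'e) chart \<Rightarrow> 'e)) \<Rightarrow>
     ('m \<Rightarrow> (('m, 'e) chart \<Rightarrow> 'e) \<Rightarrow> (('m, 'e) chart \<Rightarrow> 'e) \<Rightarrow> real)" where
  "fundamental_form G J u X Y = G u X (J u Y)"

definition almost_kaehlerian ::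
    "('m, 'e::euclidean_space) chart set \<Rightarrow>
     ('m \<Rightarrow> (('m, 'e) chart \<Rightarrow> 'e) \<Rightarrow> (('m, 'e) chart \<Rightarrow> 'e) \<Rightarrow> real) \<Rightarrow>
     ('m \<Rightarrow> (('m, 'e) chart \<Rightarrow> 'e) \<Rightarrow> (('m, 'e) chart \<Rightarrow> 'e)) \<Rightarrow> bool" where
  "almost_kaehlerian A G J \<longleftrightarrow>
     riemannian_metric A G \<and> almost_complex_structure A J \<and>
     (\<forall>X Y. vector_field A X \<longrightarrow> vector_field A Y \<longrightarrow>
        (\<forall>u\<in>atlas_carrier A. G u (J u (X u)) (J u (Y u)) = G u (X u) (Y u))) \<and>
     closed_two_form A (fundamental_form G J)"


section \<open>The cotangent bundle\<close>

type_synonym ('m, 'n) base_chart = "('m, real ^ 'n) chart"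

text \<open>A point \<open>(x, p)\<close>, where the covector \<open>p\<close> is a family of coordinate vectors.\<close>

type_synonym ('m, 'n) cotangent = "'m \<times> (('m, 'n) base_chart \<Rightarrow> real ^ 'n)"

type_synonym ('m, 'n) cotangent_chart =
  "(('m, 'n) cotangent, (real ^ 'n) \<times> (real ^ 'n)) chart"

definition cotangent_bundle :: "('m, 'n::finite) base_chart set \<Rightarrow> ('m, 'n) cotangent set" where
  "cotangent_bundle A = {(x, p). p \<in> cotangent_space A x}"

definition slit_cotangent_bundle ::
    "('m, 'n::finite) base_chart set \<Rightarrow> ('m, 'n) cotangent set" where
  "slit_cotangent_bundle A = {(x, p). p \<in> cotangent_space A x \<and> p \<noteq> (\<lambda>c. 0)}"

text \<open>The coordinates \<open>(x\<^sup>i, p\<^sub>i)\<close> on the slit cotangent bundle induced by a chart of the base.\<close>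

definition induced_chart ::
    "('m, 'n::finite) base_chart set \<Rightarrow> ('m, 'n) base_chart \<Rightarrow> ('m, 'n) cotangent_chart" where
  "induced_chart A c =
     ({u \<in> slit_cotangent_bundle A. fst u \<in> fst c}, \<lambda>u. (snd c (fst u), snd u c))"

definition slit_atlas ::
    "('m, 'n::finite) base_chart set \<Rightarrow> ('m, 'n) cotangent_chart set" where
  "slit_atlas A = induced_chart A ` A"


section \<open>Local expressions\<close>

text \<open>In this section \<open>F\<close> is the function \<open>K\<close> read in induced coordinates \<open>z = (x, p)\<close>.\<close>

definition d_base ::
    "'n::finite \<Rightarrow> ((real ^ 'n) \<times> (real ^ 'n) \<Rightarrow> real) \<Rightarrow> (real ^ 'n) \<times> (real ^ 'n) \<Rightarrow> real" where
  "d_base i f z = frechet_derivative f (at z) (axis i 1, 0)"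

definition d_fibre ::
    "'n::finite \<Rightarrow> ((real ^ 'n) \<times> (real ^ 'n) \<Rightarrow> real) \<Rightarrow> (real ^ 'n) \<times> (real ^ 'n) \<Rightarrow> real" where
  "d_fibre i f z = frechet_derivative f (at z) (0, axis i 1)"

definition g_up ::
    "((real ^ 'n::finite) \<times> (real ^ 'n) \<Rightarrow> real) \<Rightarrow> (real ^ 'n) \<times> (real ^ 'n) \<Rightarrow> real ^ 'n ^ 'n" where
  "g_up F z = (\<chi> i j. 1/2 * d_fibre i (d_fibre j (\<lambda>w. (F w)\<^sup>2)) z)"

definition g_low ::
    "((real ^ 'n::finite) \<times> (real ^ 'n) \<Rightarrow> real) \<Rightarrow> (real ^ 'n) \<times> (real ^ 'n) \<Rightarrow> real ^ 'n ^ 'n" where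
  "g_low F z = matrix_inv (g_up F z)"

definition p_up ::
    "((real ^ 'n::finite) \<times> (real ^ 'n) \<Rightarrow> real) \<Rightarrow> (real ^ 'n) \<times> (real ^ 'n) \<Rightarrow> real ^ 'n" where
  "p_up F z = g_up F z *v snd z"

text \<open>\<open>christoffel F z i j k\<close> is \<open>\<gamma>\<^sup>i\<^sub>j\<^sub>k\<close>.\<close>

definition christoffel ::
    "((real ^ 'n::finite) \<times> (real ^ 'n) \<Rightarrow> real) \<Rightarrow> (real ^ 'n) \<times> (real ^ 'n) \<Rightarrow>
     'n \<Rightarrow> 'n \<Rightarrow> 'n \<Rightarrow> real" where
  "christoffel F z i j k = 1/2 * (\<Sum>s\<in>UNIV. g_up F z $ i $ s *
     (d_base k (\<lambda>w. g_low F w $ j $ s) z + d_base j (\<lambda>w. g_low F w $ s $ k) z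
      - d_base s (\<lambda>w. g_low F w $ j $ k) z))"

definition christoffel_o ::
    "((real ^ 'n::finite) \<times> (real ^ 'n) \<Rightarrow> real) \<Rightarrow> (real ^ 'n) \<times> (real ^ 'n) \<Rightarrow>
     'n \<Rightarrow> 'n \<Rightarrow> real" where
  "christoffel_o F z j k = (\<Sum>i\<in>UNIV. christoffel F z i j k * snd z $ i)"

definition christoffel_oo ::
    "((real ^ 'n::finite) \<times> (real ^ 'n) \<Rightarrow> real) \<Rightarrow> (real ^ 'n) \<times> (real ^ 'n) \<Rightarrow> 'n \<Rightarrow> real" where
  "christoffel_oo F z j =
     (\<Sum>i\<in>UNIV. \<Sum>k\<in>UNIV. christoffel F z i j k * snd z $ i * p_up F z $ k)"

definition N_coeff ::
    "((real ^ 'n::finite) \<times> (real ^ 'n) \<Rightarrow> real) \<Rightarrow> (real ^ 'n) \<times> (real ^ 'n) \<Rightarrow>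
     'n \<Rightarrow> 'n \<Rightarrow> real" where
  "N_coeff F z i j = christoffel_o F z i j
     - 1/2 * (\<Sum>h\<in>UNIV. christoffel_oo F z h * d_fibre h (\<lambda>w. g_low F w $ i $ j) z)"

text \<open>The frame \<open>\<delta>\<^sub>i\<close>, \<open>\<partial>/\<partial>p\<^sub>i\<close> and its dual coframe, as coordinate vectors and linear forms.\<close>

definition delta_frame ::
    "((real ^ 'n::finite) \<times> (real ^ 'n) \<Rightarrow> real) \<Rightarrow> (real ^ 'n) \<times> (real ^ 'n) \<Rightarrow>
     'n \<Rightarrow> (real ^ 'n) \<times> (real ^ 'n)" where
  "delta_frame F z i = (axis i 1, \<chi> j. N_coeff F z i j)"

definition fibre_frame :: "'n::finite \<Rightarrow> (real ^ 'n) \<times> (real ^ 'n)" where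
  "fibre_frame i = (0, axis i 1)"

definition dx_form :: "'n::finite \<Rightarrow> (real ^ 'n) \<times> (real ^ 'n) \<Rightarrow> real" where
  "dx_form i e = fst e $ i"

definition delta_p_form ::
    "((real ^ 'n::finite) \<times> (real ^ 'n) \<Rightarrow> real) \<Rightarrow> (real ^ 'n) \<times> (real ^ 'n) \<Rightarrow>
     'n \<Rightarrow> (real ^ 'n) \<times> (real ^ 'n) \<Rightarrow> real" where
  "delta_p_form F z i e = snd e $ i - (\<Sum>j\<in>UNIV. N_coeff F z j i * fst e $ j)"

definition tau :: "real \<Rightarrow> real" where
  "tau k = 1/2 * k\<^sup>2"

definition G_low ::
    "(real \<Rightarrow> real) \<Rightarrow> real \<Rightarrow> real \<Rightarrow> ((real ^ 'n::finite) \<times> (real ^ 'n) \<Rightarrow> real) \<Rightarrow>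
     (real ^ 'n) \<times> (real ^ 'n) \<Rightarrow> real ^ 'n ^ 'n" where
  "G_low v \<alpha> \<beta> F z = (\<chi> i j. 1/\<beta> * g_low F z $ i $ j
     + v (tau (F z)) / (\<alpha> * \<beta>) * snd z $ i * snd z $ j)"

definition G_up ::
    "(real \<Rightarrow> real) \<Rightarrow> real \<Rightarrow> real \<Rightarrow> ((real ^ 'n::finite) \<times> (real ^ 'n) \<Rightarrow> real) \<Rightarrow>
     (real ^ 'n) \<times> (real ^ 'n) \<Rightarrow> real ^ 'n ^ 'n" where
  "G_up v \<alpha> \<beta> F z = matrix_inv (G_low v \<alpha> \<beta> F z)"


section \<open>Cartan spaces and the structures \<open>G\<close> and \<open>J\<close>\<close>

definition local_K ::
    "('m, 'n::finite) base_chart set \<Rightarrow> (('m, 'n) cotangent \<Rightarrow> real) \<Rightarrow> ('m, 'n) base_chart \<Rightarrow>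
     (real ^ 'n) \<times> (real ^ 'n) \<Rightarrow> real" where
  "local_K A K c = K \<circ> chart_inv (induced_chart A c)"

definition cartan_space ::
    "('m::{t2_space, second_countable_topology}, 'n::finite) base_chart set \<Rightarrow>
     (('m, 'n) cotangent \<Rightarrow> real) \<Rightarrow> bool" where
  "cartan_space A K \<longleftrightarrow> smooth_atlas A \<and>
     (\<forall>u\<in>cotangent_bundle A. K u \<ge> 0) \<and>
     smooth_function (slit_atlas A) K \<and>
     (\<forall>(x, p)\<in>cotangent_bundle A. \<forall>t>0. K (x, \<lambda>c. t *\<^sub>R p c) = t * K (x, p)) \<and>
     (\<forall>c\<in>A. \<forall>z\<in>chart_image (induced_chart A c). \<forall>\<xi>. \<xi> \<noteq> 0 \<longrightarrow>
        \<xi> \<bullet> (g_up (local_K A K c) z *v \<xi>) > 0)"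

text \<open>\<open>G = G\<^sub>i\<^sub>j dx\<^sup>i dx\<^sup>j + G\<^sup>i\<^sup>j \<delta>p\<^sub>i \<delta>p\<^sub>j\<close> in all induced coordinates.\<close>

definition metric_given_by ::
    "('m, 'n::finite) base_chart set \<Rightarrow> (('m, 'n) cotangent \<Rightarrow> real) \<Rightarrow>
     (real \<Rightarrow> real) \<Rightarrow> real \<Rightarrow> real \<Rightarrow>
     (('m, 'n) cotangent \<Rightarrow> (('m, 'n) cotangent_chart \<Rightarrow> (real ^ 'n) \<times> (real ^ 'n)) \<Rightarrow>
        (('m, 'n) cotangent_chart \<Rightarrow> (real ^ 'n) \<times> (real ^ 'n)) \<Rightarrow> real) \<Rightarrow> bool" where
  "metric_given_by A K v \<alpha> \<beta> G \<longleftrightarrow>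
     (\<forall>c\<in>A. \<forall>u\<in>fst (induced_chart A c).
        \<forall>X\<in>tangent_space (slit_atlas A) u. \<forall>Y\<in>tangent_space (slit_atlas A) u.
        (let F = local_K A K c; z = snd (induced_chart A c) u;
             X' = X (induced_chart A c); Y' = Y (induced_chart A c)
         in G u X Y =
              (\<Sum>i\<in>UNIV. \<Sum>j\<in>UNIV. G_low v \<alpha> \<beta> F z $ i $ j * dx_form i X' * dx_form j Y')
            + (\<Sum>i\<in>UNIV. \<Sum>j\<in>UNIV.
                 G_up v \<alpha> \<beta> F z $ i $ j * delta_p_form F z i X' * delta_p_form F z j Y')))"

text \<open>\<open>J(\<delta>\<^sub>i) = G\<^sub>i\<^sub>k \<partial>/\<partial>p\<^sub>k\<close> and \<open>J(\<partial>/\<partial>p\<^sub>i) = - G\<^sup>i\<^sup>k \<delta>\<^sub>k\<close> in all induced coordinates.\<close>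

definition complex_structure_given_by ::
    "('m, 'n::finite) base_chart set \<Rightarrow> (('m, 'n) cotangent \<Rightarrow> real) \<Rightarrow>
     (real \<Rightarrow> real) \<Rightarrow> real \<Rightarrow> real \<Rightarrow>
     (('m, 'n) cotangent \<Rightarrow> (('m, 'n) cotangent_chart \<Rightarrow> (real ^ 'n) \<times> (real ^ 'n)) \<Rightarrow>
        (('m, 'n) cotangent_chart \<Rightarrow> (real ^ 'n) \<times> (real ^ 'n))) \<Rightarrow> bool" where
  "complex_structure_given_by A K v \<alpha> \<beta> J \<longleftrightarrow>
     (\<forall>c\<in>A. \<forall>u\<in>fst (induced_chart A c). \<forall>i.
        (let F = local_K A K c; z = snd (induced_chart A c) u;
             vec = coord_vec (slit_atlas A) (induced_chart A c) u
         in J u (vec (delta_frame F z i)) =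
              vec (\<Sum>k\<in>UNIV. G_low v \<alpha> \<beta> F z $ i $ k *\<^sub>R fibre_frame k) \<and>
            J u (vec (fibre_frame i)) =
              vec (- (\<Sum>k\<in>UNIV. G_up v \<alpha> \<beta> F z $ i $ k *\<^sub>R delta_frame F z k))))"

end

theory Submission
  imports Defs
begin

text \<open>In the adapted frame \<open>J\<close> is given by two mutually inverse symmetric matrices, which are also the
  Gram matrices of \<open>G\<close>; hence \<open>G\<close> is Hermitian and \<open>\<theta> = \<delta>p\<^sub>i \<and> dx\<^sup>i\<close>, whatever \<open>v\<close>, \<open>\<alpha>\<close>, \<open>\<beta>\<close> are.
  Because \<open>N\<^sub>i\<^sub>j\<close> is symmetric, \<open>\<delta>p\<^sub>i\<close> may be replaced by \<open>dp\<^sub>i\<close>, so \<open>\<theta>\<close> is the canonical symplectic form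
  \<open>dp\<^sub>i \<and> dx\<^sup>i\<close>: it has constant coefficients in every induced chart. The symmetry of \<open>N\<^sub>i\<^sub>j\<close> comes from
  that of \<open>g\<^sup>i\<^sup>j\<close>, i.e. from the equality of mixed second derivatives of \<open>K\<^sup>2\<close>. Positivity of \<open>G\<^sub>i\<^sub>j\<close> is
  the Cauchy-Schwarz inequality for \<open>g\<^sup>i\<^sup>j\<close> together with \<open>K\<^sup>2 = g\<^sup>i\<^sup>j p\<^sub>i p\<^sub>j\<close>.\<close>


section \<open>Second derivatives\<close>

text \<open>The derivative is chosen from the predicate \<open>has_derivative\<close>, which sees
  only the germ of a function at \<open>z\<close>; so the equation holds whether or not the
  functions are differentiable.\<close>

lemma frechet_derivative_cong_eventually:
  fixes f g :: "'a::real_normed_vector \<Rightarrow> 'b::real_normed_vector"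
  assumes "\<forall>\<^sub>F w in nhds z. f w = g w"
  shows "frechet_derivative f (at z) = frechet_derivative g (at z)"
proof -
  have ev: "\<forall>\<^sub>F w in at z. f w = g w" "\<forall>\<^sub>F w in at z. g w = f w"
    using assms by (auto simp: eventually_at_filter elim: eventually_mono)
  have fz: "f z = g z"
    using assms by (rule eventually_nhds_x_imp_x)
  have "(f has_derivative D) (at z) \<longleftrightarrow> (g has_derivative D) (at z)" for D
    using has_derivative_transform_eventually[of f D z UNIV g]
      has_derivative_transform_eventually[of g D z UNIV f] ev fz by auto
  then show ?thesis
    unfolding frechet_derivative_def by simp
qed

lemma eventually_nhds_open:
  "open S \<Longrightarrow> z \<in> S \<Longrightarrow> (\<And>w. w \<in> S \<Longrightarrow> P w) \<Longrightarrow> \<forall>\<^sub>F w in nhds z. P w"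
  by (auto simp: eventually_nhds)

lemma has_real_derivative_along_line:
  fixes f :: "'a::real_normed_vector \<Rightarrow> real"
  assumes "f differentiable (at (w + s *\<^sub>R h))"
  shows "((\<lambda>s. f (w + s *\<^sub>R h)) has_real_derivative frechet_derivative f (at (w + s *\<^sub>R h)) h) (at s)"
proof -
  let ?D = "frechet_derivative f (at (w + s *\<^sub>R h))"
  have D: "(f has_derivative ?D) (at (w + s *\<^sub>R h))"
    using assms by (simp add: frechet_derivative_works)
  have "((\<lambda>s. f (w + s *\<^sub>R h)) has_derivative (\<lambda>r. ?D (r *\<^sub>R h))) (at s)"
    by (rule has_derivative_compose[where f = "\<lambda>s. w + s *\<^sub>R h" and x = s, OF _ D]) (auto intro!: derivative_eq_intros)
  moreover have "?D (r *\<^sub>R h) = ?D h * r" for r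
    using linear_cmul[OF linear_frechet_derivative[OF assms], of r h] by simp
  ultimately show ?thesis
    by (simp add: has_field_derivative_def)
qed

text \<open>The mean value theorem is applied twice: to the difference \<open>\<phi>\<close> of
  \<open>f\<close> along two parallel sides of a parallelogram, then to the derivative in direction
  \<open>h\<close> along direction \<open>k\<close>. The second difference is symmetric in
  \<open>h\<close> and \<open>k\<close>, which the next lemma exploits.\<close>

lemma second_difference_eq_mixed_derivative:
  fixes f :: "'a::real_normed_vector \<Rightarrow> real"
  assumes t: "t > 0"
    and sub: "\<And>a b. 0 \<le> a \<Longrightarrow> a \<le> t \<Longrightarrow> 0 \<le> b \<Longrightarrow> b \<le> t \<Longrightarrow> z + a *\<^sub>R h + b *\<^sub>R k \<in> S"
    and df: "\<And>w. w \<in> S \<Longrightarrow> f differentiable (at w)"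
    and ddf: "\<And>w. w \<in> S \<Longrightarrow> (\<lambda>w. frechet_derivative f (at w) h) differentiable (at w)"
  shows "\<exists>a b. 0 < a \<and> a < t \<and> 0 < b \<and> b < t \<and>
    f (z + t *\<^sub>R h + t *\<^sub>R k) - f (z + t *\<^sub>R h) - f (z + t *\<^sub>R k) + f z =
    t * t * frechet_derivative (\<lambda>w. frechet_derivative f (at w) h) (at (z + a *\<^sub>R h + b *\<^sub>R k)) k"
proof -
  let ?Dh = "\<lambda>w. frechet_derivative f (at w) h"
  define \<phi> where "\<phi> s = f (z + t *\<^sub>R k + s *\<^sub>R h) - f (z + s *\<^sub>R h)" for s
  have "(\<phi> has_real_derivative ?Dh (z + t *\<^sub>R k + s *\<^sub>R h) - ?Dh (z + s *\<^sub>R h)) (at s)"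
    if "0 \<le> s" "s \<le> t" for s
    unfolding \<phi>_def
    using sub[of s t] sub[of s 0] that t
    by (intro DERIV_diff has_real_derivative_along_line df) (auto simp: algebra_simps)
  then obtain a where a: "0 < a" "a < t"
    "\<phi> t - \<phi> 0 = t * (?Dh (z + t *\<^sub>R k + a *\<^sub>R h) - ?Dh (z + a *\<^sub>R h))"
    using MVT2[OF t, of \<phi> "\<lambda>s. ?Dh (z + t *\<^sub>R k + s *\<^sub>R h) - ?Dh (z + s *\<^sub>R h)"] by auto
  let ?\<psi> = "\<lambda>s. ?Dh (z + a *\<^sub>R h + s *\<^sub>R k)"
  have "(?\<psi> has_real_derivative frechet_derivative ?Dh (at (z + a *\<^sub>R h + s *\<^sub>R k)) k) (at s)"
    if "0 \<le> s" "s \<le> t" for s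
    using sub[of a s] that a by (intro has_real_derivative_along_line ddf) auto
  then obtain b where b: "0 < b" "b < t"
    "?\<psi> t - ?\<psi> 0 = t * frechet_derivative ?Dh (at (z + a *\<^sub>R h + b *\<^sub>R k)) k"
    using MVT2[OF t, of ?\<psi> "\<lambda>s. frechet_derivative ?Dh (at (z + a *\<^sub>R h + s *\<^sub>R k)) k"] by auto
  have e: "z + t *\<^sub>R k + a *\<^sub>R h = z + a *\<^sub>R h + t *\<^sub>R k" "z + t *\<^sub>R k + t *\<^sub>R h = z + t *\<^sub>R h + t *\<^sub>R k"
    by (simp_all add: algebra_simps)
  have "f (z + t *\<^sub>R h + t *\<^sub>R k) - f (z + t *\<^sub>R h) - f (z + t *\<^sub>R k) + f z = \<phi> t - \<phi> 0"
    by (simp add: \<phi>_def e)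
  also have "\<dots> = t * (?\<psi> t - ?\<psi> 0)"
    using a(3) by (simp add: e)
  finally show ?thesis
    using a(1,2) b by (metis mult.assoc)
qed

text \<open>Schwarz's theorem. The second difference over a small parallelogram, read in either
  order, expresses one number through both mixed derivatives at points close to \<open>z\<close>;
  continuity brings these points to \<open>z\<close>.\<close>

lemma mixed_derivatives_commute:
  fixes f :: "'a::real_normed_vector \<Rightarrow> real"
  assumes S: "open S" "z \<in> S"
    and df: "\<And>w. w \<in> S \<Longrightarrow> f differentiable (at w)"
    and ddf: "\<And>w l. w \<in> S \<Longrightarrow> (\<lambda>w. frechet_derivative f (at w) l) differentiable (at w)"
    and cont: "\<And>l m. continuous_on S
      (\<lambda>w. frechet_derivative (\<lambda>w. frechet_derivative f (at w) l) (at w) m)"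
  shows "frechet_derivative (\<lambda>w. frechet_derivative f (at w) h) (at z) k =
    frechet_derivative (\<lambda>w. frechet_derivative f (at w) k) (at z) h"
proof (rule ccontr)
  let ?DD = "\<lambda>l m w. frechet_derivative (\<lambda>w. frechet_derivative f (at w) l) (at w) m"
  assume ne: "?DD h k z \<noteq> ?DD k h z"
  \<comment> \<open>Half the distance of the two values: no number lies within \<open>e\<close> of
    both.\<close>
  define e where "e = dist (?DD h k z) (?DD k h z) / 2"
  have e: "e > 0"
    using ne by (simp add: e_def)
  have ev: "\<forall>\<^sub>F w in nhds z. w \<in> S \<and> dist (?DD h k w) (?DD h k z) < e \<and> dist (?DD k h w) (?DD k h z) < e"
  proof -
    have "(?DD l m \<longlongrightarrow> ?DD l m z) (nhds z)" for l m
      using cont[of l m] S tendsto_at_iff_tendsto_nhds[of "?DD l m" z]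
      by (auto simp: continuous_on_eq_continuous_at isCont_def)
    then have "\<forall>\<^sub>F w in nhds z. dist (?DD l m w) (?DD l m z) < e" for l m
      using e by (simp add: tendsto_iff)
    then show ?thesis
      using S by (intro eventually_conj eventually_nhds_in_open) auto
  qed
  then obtain d where d: "d > 0" and
    D: "\<And>w. dist w z < d \<Longrightarrow> w \<in> S \<and> dist (?DD h k w) (?DD h k z) < e \<and> dist (?DD k h w) (?DD k h z) < e"
    by (auto simp: eventually_nhds_metric)
  \<comment> \<open>Small enough for the parallelogram with sides t h and t k to stay in the ball of
    radius \<open>d\<close>; the summand 1 keeps the denominator positive when \<open>h\<close> and
    \<open>k\<close> vanish.\<close>
  define t where "t = d / (norm h + norm k + 1)"
  have hk: "norm h + norm k + 1 > 0"
    by (smt (verit) norm_ge_zero)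
  have t: "t > 0"
    using d hk by (simp add: t_def)
  have near: "dist (z + a *\<^sub>R h + b *\<^sub>R k) z < d" if "0 \<le> a" "a \<le> t" "0 \<le> b" "b \<le> t" for a b
  proof -
    have "norm (a *\<^sub>R h + b *\<^sub>R k) \<le> a * norm h + b * norm k"
      using norm_triangle_ineq[of "a *\<^sub>R h" "b *\<^sub>R k"] that by simp
    also have "\<dots> \<le> t * norm h + t * norm k"
      using that by (intro add_mono mult_right_mono) auto
    also have "\<dots> < t * (norm h + norm k + 1)"
      using t by (simp add: algebra_simps)
    also have "\<dots> = d"
      using hk by (simp add: t_def)
    finally show ?thesis
      by (simp add: dist_norm add.assoc)
  qed
  obtain a b where ab: "0 < a" "a < t" "0 < b" "b < t"
    "f (z + t *\<^sub>R h + t *\<^sub>R k) - f (z + t *\<^sub>R h) - f (z + t *\<^sub>R k) + f z = t * t * ?DD h k (z + a *\<^sub>R h + b *\<^sub>R k)"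
    using second_difference_eq_mixed_derivative[OF t, of z h k S f] D near df ddf by blast
  have near': "dist (z + a *\<^sub>R k + b *\<^sub>R h) z < d" if "0 \<le> a" "a \<le> t" "0 \<le> b" "b \<le> t" for a b
    using near[of b a] that by (simp add: algebra_simps)
  obtain a' b' where ab': "0 < a'" "a' < t" "0 < b'" "b' < t"
    "f (z + t *\<^sub>R k + t *\<^sub>R h) - f (z + t *\<^sub>R k) - f (z + t *\<^sub>R h) + f z = t * t * ?DD k h (z + a' *\<^sub>R k + b' *\<^sub>R h)"
    using second_difference_eq_mixed_derivative[OF t, of z k h S f] D near' df ddf by blast
  have "t * t * ?DD h k (z + a *\<^sub>R h + b *\<^sub>R k) = t * t * ?DD k h (z + a' *\<^sub>R k + b' *\<^sub>R h)"
    using ab(5) ab'(5) by (simp add: algebra_simps)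
  then have eq: "?DD h k (z + a *\<^sub>R h + b *\<^sub>R k) = ?DD k h (z + a' *\<^sub>R k + b' *\<^sub>R h)"
    using t by simp
  have "dist (?DD h k (z + a *\<^sub>R h + b *\<^sub>R k)) (?DD h k z) < e"
    "dist (?DD k h (z + a' *\<^sub>R k + b' *\<^sub>R h)) (?DD k h z) < e"
    using D near[of a b] near'[of a' b'] ab ab' by auto
  then show False
    using dist_triangle_half_r unfolding eq e_def by blast
qed

section \<open>Functions of class C^2 and their squares\<close>

lemma Ck_on_2_iff:
  "Ck_on 2 S f \<longleftrightarrow> (\<forall>w\<in>S. f differentiable (at w)) \<and>
    (\<forall>h. \<forall>w\<in>S. (\<lambda>w. frechet_derivative f (at w) h) differentiable (at w)) \<and>
    (\<forall>h k. continuous_on S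
      (\<lambda>w. frechet_derivative (\<lambda>w. frechet_derivative f (at w) h) (at w) k))"
  by (auto simp: numeral_2_eq_2)

lemma frechet_derivative_power2:
  fixes f :: "'a::real_normed_vector \<Rightarrow> real"
  assumes "f differentiable (at w)"
  shows "(\<lambda>w. (f w)\<^sup>2) differentiable (at w)"
    and "frechet_derivative (\<lambda>w. (f w)\<^sup>2) (at w) h = 2 * f w * frechet_derivative f (at w) h"
proof -
  have "(f has_derivative frechet_derivative f (at w)) (at w)"
    using assms by (simp add: frechet_derivative_works)
  from has_derivative_power[OF this, of 2]
  have D: "((\<lambda>w. (f w)\<^sup>2) has_derivative (\<lambda>h. 2 * f w * frechet_derivative f (at w) h)) (at w)"
    by (simp add: mult_ac)
  then show "(\<lambda>w. (f w)\<^sup>2) differentiable (at w)"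
    by (auto simp: differentiable_def)
  show "frechet_derivative (\<lambda>w. (f w)\<^sup>2) (at w) h = 2 * f w * frechet_derivative f (at w) h"
    using frechet_derivative_at[OF D] by metis
qed

text \<open>The tensor g^ij is half the fibre Hessian of K^2, so the C^2 property has to pass from K
  to its square; this follows from the rules for powers and products.\<close>

lemma Ck_on_2_power2:
  fixes f :: "'a::real_normed_vector \<Rightarrow> real"
  assumes S: "open S" and f: "Ck_on 2 S f"
  shows "Ck_on 2 S (\<lambda>w. (f w)\<^sup>2)"
proof -
  let ?Q = "\<lambda>w. (f w)\<^sup>2"
  let ?D = "\<lambda>h w. frechet_derivative f (at w) h"
  have df: "f differentiable (at w)" if "w \<in> S" for w
    using f that by (simp add: Ck_on_2_iff)
  have ddf: "?D h differentiable (at w)" if "w \<in> S" for w h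
    using f that by (simp add: Ck_on_2_iff)
  have DQ: "((\<lambda>w. frechet_derivative ?Q (at w) h) has_derivative
      (\<lambda>k. 2 * (?D k w * ?D h w + f w * frechet_derivative (?D h) (at w) k))) (at w)"
    if "w \<in> S" for w h
  \<comment> \<open>The formula 2 f Df for the first derivative is known only on \<open>S\<close>;
    openness of \<open>S\<close> lets it be differentiated again.\<close>
  proof (rule has_derivative_transform_within_open[OF _ S that])
    show "((\<lambda>w. 2 * f w * ?D h w) has_derivative
      (\<lambda>k. 2 * (?D k w * ?D h w + f w * frechet_derivative (?D h) (at w) k))) (at w)"
      using df[OF that] ddf[OF that, of h] unfolding frechet_derivative_works
      by (auto intro!: derivative_eq_intros simp: algebra_simps)
    show "2 * f w * ?D h w = frechet_derivative ?Q (at w) h" if "w \<in> S" for w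
      using frechet_derivative_power2[OF df[OF that]] by simp
  qed
  have "continuous_on S (\<lambda>w. 2 * (?D k w * ?D h w + f w * frechet_derivative (?D h) (at w) k))" for h k
    using f df ddf
    by (intro continuous_intros) (auto simp: Ck_on_2_iff intro!: continuous_at_imp_continuous_on differentiable_imp_continuous_within)
  then have "continuous_on S (\<lambda>w. frechet_derivative (\<lambda>w. frechet_derivative ?Q (at w) h) (at w) k)" for h k
    using frechet_derivative_at[OF DQ, of _ h, THEN fun_cong, of _ k]
    by (rule continuous_on_eq) auto
  then show ?thesis
    using DQ frechet_derivative_power2(1)[OF df]
    unfolding Ck_on_2_iff differentiable_def by blast
qed

lemma Ck_on_2_mixed_derivatives_commute:
  fixes f :: "'a::real_normed_vector \<Rightarrow> real"
  assumes "open S" "z \<in> S" "Ck_on 2 S f"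
  shows "frechet_derivative (\<lambda>w. frechet_derivative f (at w) h) (at z) k =
    frechet_derivative (\<lambda>w. frechet_derivative f (at w) k) (at z) h"
  using assms unfolding Ck_on_2_iff by (intro mixed_derivatives_commute[of S]) auto

text \<open>The derivatives of such a function are again constant on \<open>S\<close>, with value 0,
  so the value \<open>r\<close> is generalised in the induction. This gives smoothness of the
  coefficients of the fundamental form.\<close>

lemma Ck_on_constant:
  assumes "open S" "\<And>w. w \<in> S \<Longrightarrow> f w = r"
  shows "Ck_on k S f"
  using assms(2)
proof (induction k arbitrary: f r)
  case 0
  then show ?case
    using continuous_on_eq[OF continuous_on_const, of S r f] by simp
next
  case (Suc k)
  have "(f has_derivative (\<lambda>h. 0)) (at w)" if "w \<in> S" for w
    using has_derivative_transform_within_open[OF has_derivative_const assms(1) that, of r f] Suc.prems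
    by simp
  then have "f differentiable (at w)" and "frechet_derivative f (at w) = (\<lambda>h. 0)" if "w \<in> S" for w
    using that frechet_derivative_at[of f "\<lambda>h. 0" w] by (auto simp: differentiable_def)
  then show ?case
    using Suc.IH by simp
qed

section \<open>Symmetric positive definite matrices\<close>

text \<open>Positivity is applied to (b . Mb) a - (a . Mb) b, the component of \<open>a\<close> that
  is M-orthogonal to \<open>b\<close>, scaled so as to avoid division.\<close>

lemma symmetric_posdef_Cauchy_Schwarz:
  fixes M :: "real ^ 'n ^ 'n"
  assumes sym: "transpose M = M" and pos: "\<And>\<xi>. \<xi> \<noteq> 0 \<Longrightarrow> \<xi> \<bullet> (M *v \<xi>) > 0"
  shows "(a \<bullet> (M *v b))\<^sup>2 \<le> (a \<bullet> (M *v a)) * (b \<bullet> (M *v b))"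
proof (cases "b = 0")
  case False
  let ?c = "b \<bullet> (M *v b)" and ?s = "a \<bullet> (M *v b)"
  have c: "?c > 0"
    using pos False by blast
  have ba: "b \<bullet> (M *v a) = ?s"
    using dot_lmul_matrix[of a M b] transpose_matrix_vector[of M a] sym by (simp add: inner_commute)
  have "0 \<le> (?c *\<^sub>R a - ?s *\<^sub>R b) \<bullet> (M *v (?c *\<^sub>R a - ?s *\<^sub>R b))"
    using pos[of "?c *\<^sub>R a - ?s *\<^sub>R b"] by (cases "?c *\<^sub>R a - ?s *\<^sub>R b = 0") auto
  also have "\<dots> = ?c * ((a \<bullet> (M *v a)) * ?c - ?s\<^sup>2)"
    by (simp add: matrix_vector_mult_diff_distrib matrix_vector_mult_scaleR inner_diff_left
        inner_diff_right ba power2_eq_square algebra_simps)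
  finally show ?thesis
    using c by (simp add: zero_le_mult_iff)
qed simp

text \<open>The quadratic form takes the value 0 on the kernel, so the kernel is trivial.\<close>

lemma posdef_invertible:
  fixes M :: "real ^ 'n ^ 'n"
  assumes "\<And>\<xi>. \<xi> \<noteq> 0 \<Longrightarrow> \<xi> \<bullet> (M *v \<xi>) > 0"
  shows "invertible M"
proof -
  have "x = 0" if "M *v x = 0" for x
    using assms[of x] that by force
  then show ?thesis
    unfolding invertible_left_inverse matrix_left_invertible_ker by blast
qed

lemma matrix_inv_inverse:
  assumes "invertible M"
  shows "M ** matrix_inv M = mat 1" "matrix_inv M ** M = mat 1"
  using someI_ex[OF assms[unfolded invertible_def]] unfolding matrix_inv_def by auto

text \<open>The transpose of a right inverse of \<open>M\<close> is a left inverse of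
  \<open>transpose M = M\<close>, and left and right inverses agree.\<close>

lemma transpose_matrix_inv:
  fixes M :: "real ^ 'n ^ 'n"
  assumes inv: "invertible M" and sym: "transpose M = M"
  shows "transpose (matrix_inv M) = matrix_inv M"
proof -
  have "transpose (matrix_inv M) ** M = mat 1"
    using arg_cong[OF matrix_inv_inverse(1)[OF inv], of transpose] sym
    by (simp add: matrix_transpose_mul)
  then show ?thesis
    using matrix_inv_inverse(1)[OF inv] by (metis matrix_mul_assoc matrix_mul_lid matrix_mul_rid)
qed

text \<open>The form of the inverse at \<open>\<xi>\<close> is the form of \<open>M\<close> at the
  preimage \<open>?\<eta>\<close> of \<open>\<xi>\<close>.\<close>

lemma symmetric_posdef_matrix_inv:
  fixes M :: "real ^ 'n ^ 'n"
  assumes sym: "transpose M = M" and pos: "\<And>\<xi>. \<xi> \<noteq> 0 \<Longrightarrow> \<xi> \<bullet> (M *v \<xi>) > 0"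
    and ne: "\<xi> \<noteq> 0"
  shows "\<xi> \<bullet> (matrix_inv M *v \<xi>) > 0"
proof -
  have inv: "invertible M"
    using pos by (rule posdef_invertible)
  let ?\<eta> = "matrix_inv M *v \<xi>"
  have M\<eta>: "M *v ?\<eta> = \<xi>"
    by (simp add: matrix_vector_mul_assoc matrix_inv_inverse[OF inv])
  then have "?\<eta> \<noteq> 0"
    using ne by auto
  from pos[OF this] show ?thesis
    by (simp only: M\<eta> inner_commute)
qed

lemma symmetric_matrix_component: "transpose M = M \<Longrightarrow> M $ i $ j = M $ j $ i"
  by (metis transpose_def vec_lambda_beta)

lemma quadratic_form_eq_sum:
  fixes M :: "real ^ 'n ^ 'm"
  shows "a \<bullet> (M *v b) = (\<Sum>i\<in>UNIV. \<Sum>j\<in>UNIV. M $ i $ j * a $ i * b $ j)"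
  by (simp add: inner_vec_def matrix_vector_mult_def sum_distrib_left mult_ac)

lemma matrix_vector_mult_minus: "(M :: real ^ 'n ^ 'm) *v - x = - (M *v x)"
  using matrix_vector_mult_diff_distrib[of M 0 x] by simp

section \<open>The local geometry of a Cartan space\<close>

lemma vec_eq_sum_axis: "(x :: real ^ 'n) = (\<Sum>j\<in>UNIV. x $ j *\<^sub>R axis j 1)"
  using basis_expansion[of x] by (simp add: scalar_mult_eq_scaleR)

text \<open>Both directions are expanded in the fibre basis, since a derivative is linear in its
  direction. This turns second derivatives along an arbitrary vertical direction, such as the ray in
  Euler's identity, into values of g^ij.\<close>

lemma inner_g_up:
  fixes F :: "(real ^ 'n::finite) \<times> (real ^ 'n) \<Rightarrow> real"
  assumes S: "open S" "z \<in> S" and F: "Ck_on 2 S F"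
  shows "a \<bullet> (g_up F z *v b) =
    1/2 * frechet_derivative (\<lambda>w. frechet_derivative (\<lambda>w. (F w)\<^sup>2) (at w) (0, b)) (at z) (0, a)"
proof -
  let ?Q = "\<lambda>w. (F w)\<^sup>2"
  let ?D = "\<lambda>h w. frechet_derivative ?Q (at w) h"
  let ?e = "\<lambda>i. (0 :: real ^ 'n, axis i 1 :: real ^ 'n)"
  have Q: "Ck_on 2 S ?Q"
    using S(1) F by (rule Ck_on_2_power2)
  have pair: "(0, x) = (\<Sum>j\<in>UNIV. x $ j *\<^sub>R ?e j)" for x :: "real ^ 'n"
    by (rule prod_eqI) (simp_all add: fst_sum snd_sum flip: vec_eq_sum_axis)
  have lin: "linear (\<lambda>h. ?D h w)" if "w \<in> S" for w
    using Q that by (auto simp: Ck_on_2_iff intro!: linear_frechet_derivative)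
  \<comment> \<open>Stated on all of \<open>S\<close> and not only at \<open>z\<close>, because the
    expansion is differentiated once more.\<close>
  have "?D (0, b) w = (\<Sum>j\<in>UNIV. b $ j * ?D (?e j) w)" if "w \<in> S" for w
    by (subst pair) (simp only: linear_sum[OF lin[OF that]] linear_cmul[OF lin[OF that]] real_scaleR_def)
  then have "frechet_derivative (?D (0, b)) (at z) =
      frechet_derivative (\<lambda>w. \<Sum>j\<in>UNIV. b $ j * ?D (?e j) w) (at z)"
    by (intro frechet_derivative_cong_eventually eventually_nhds_open[OF S]) auto
  also have "\<dots> = (\<lambda>h. \<Sum>j\<in>UNIV. b $ j * frechet_derivative (?D (?e j)) (at z) h)"
  proof (rule frechet_derivative_at[symmetric])
    have "(?D (?e j) has_derivative frechet_derivative (?D (?e j)) (at z)) (at z)" for j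
      using Q S(2) by (simp add: Ck_on_2_iff flip: frechet_derivative_works)
    then show "((\<lambda>w. \<Sum>j\<in>UNIV. b $ j * ?D (?e j) w) has_derivative
        (\<lambda>h. \<Sum>j\<in>UNIV. b $ j * frechet_derivative (?D (?e j)) (at z) h)) (at z)"
      by (intro has_derivative_sum has_derivative_mult_right)
  qed
  finally have DDb: "frechet_derivative (?D (0, b)) (at z) h =
      (\<Sum>j\<in>UNIV. b $ j * frechet_derivative (?D (?e j)) (at z) h)" for h
    by simp
  have dif: "?D (?e j) differentiable (at z)" for j
    using Q S(2) by (simp add: Ck_on_2_iff)
  have DDa: "frechet_derivative (?D (?e j)) (at z) (0, a) =
      (\<Sum>i\<in>UNIV. a $ i * frechet_derivative (?D (?e j)) (at z) (?e i))" for j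
    by (subst pair) (simp only: linear_sum[OF linear_frechet_derivative[OF dif]]
        linear_cmul[OF linear_frechet_derivative[OF dif]] real_scaleR_def)
  have g: "g_up F z $ i $ j = 1/2 * frechet_derivative (?D (?e j)) (at z) (?e i)" for i j
    by (simp add: g_up_def d_fibre_def[abs_def])
  show ?thesis
    unfolding DDb DDa g quadratic_form_eq_sum
    by (subst sum.swap) (simp add: sum_distrib_left mult_ac)
qed

text \<open>The entries are mixed second derivatives of a C^2 function, which commute by Schwarz's
  theorem.\<close>

lemma transpose_g_up:
  fixes F :: "(real ^ 'n::finite) \<times> (real ^ 'n) \<Rightarrow> real"
  assumes S: "open S" "z \<in> S" and F: "Ck_on 2 S F"
  shows "transpose (g_up F z) = g_up F z"
  using Ck_on_2_mixed_derivatives_commute[OF S Ck_on_2_power2[OF S(1) F]]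
  by (simp add: transpose_def g_up_def d_fibre_def[abs_def] vec_eq_iff)

text \<open>Euler's identity, obtained by differentiating \<open>K(x, t p)\<^sup>2 = t\<^sup>2 K(x, p)\<^sup>2\<close> twice at \<open>t = 1\<close>.\<close>

lemma square_eq_g_up:
  fixes F :: "(real ^ 'n::finite) \<times> (real ^ 'n) \<Rightarrow> real"
  assumes S: "open S" "z \<in> S" and F: "Ck_on 2 S F"
    and hom: "\<And>t. t > 0 \<Longrightarrow> (fst z, t *\<^sub>R snd z) \<in> S \<and> F (fst z, t *\<^sub>R snd z) = t * F z"
  shows "(F z)\<^sup>2 = snd z \<bullet> (g_up F z *v snd z)"
proof -
  let ?Q = "\<lambda>w. (F w)\<^sup>2"
  let ?h = "(0 :: real ^ 'n, snd z)"
  let ?D = "\<lambda>w. frechet_derivative ?Q (at w) ?h"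
  have Q: "Ck_on 2 S ?Q"
    using S(1) F by (rule Ck_on_2_power2)
  have line: "z + s *\<^sub>R ?h = (fst z, (1 + s) *\<^sub>R snd z)" for s
    by (rule prod_eqI) (simp_all add: algebra_simps)
  \<comment> \<open>The bound keeps the factor \<open>1 + s\<close> positive, as homogeneity
    demands; it is an open condition around \<open>s = 0\<close>, so the identities may be
    differentiated.\<close>
  have in_S: "z + s *\<^sub>R ?h \<in> S" and Qs: "?Q (z + s *\<^sub>R ?h) = (1 + s)\<^sup>2 * ?Q z" if "s > -1" for s
    using hom[of "1 + s"] that unfolding line by (simp_all add: power_mult_distrib)
  have D: "?D (z + s *\<^sub>R ?h) = 2 * (1 + s) * ?Q z" if "s > -1" for s
  proof (rule DERIV_unique)
    show "((\<lambda>s. ?Q (z + s *\<^sub>R ?h)) has_real_derivative ?D (z + s *\<^sub>R ?h)) (at s)"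
      using Q in_S[OF that] by (intro has_real_derivative_along_line) (simp add: Ck_on_2_iff)
    have "((\<lambda>s. (1 + s)\<^sup>2 * ?Q z) has_real_derivative 2 * (1 + s) * ?Q z) (at s)"
      by (auto intro!: derivative_eq_intros)
    then show "((\<lambda>s. ?Q (z + s *\<^sub>R ?h)) has_real_derivative 2 * (1 + s) * ?Q z) (at s)"
      by (rule has_field_derivative_transform_within_open[where S = "{-1<..}"])
        (use that Qs in auto)
  qed
  have "frechet_derivative ?D (at (z + 0 *\<^sub>R ?h)) ?h = 2 * ?Q z"
  proof (rule DERIV_unique)
    show "((\<lambda>s. ?D (z + s *\<^sub>R ?h)) has_real_derivative frechet_derivative ?D (at (z + 0 *\<^sub>R ?h)) ?h) (at 0)"
      using Q in_S[of 0] by (intro has_real_derivative_along_line) (simp add: Ck_on_2_iff)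
    have "((\<lambda>s. 2 * (1 + s) * ?Q z) has_real_derivative 2 * ?Q z) (at 0)"
      by (auto intro!: derivative_eq_intros)
    then show "((\<lambda>s. ?D (z + s *\<^sub>R ?h)) has_real_derivative 2 * ?Q z) (at 0)"
      by (rule has_field_derivative_transform_within_open[where S = "{-1<..}"])
        (use D in auto)
  qed
  then show ?thesis
    using inner_g_up[OF S F, of "snd z" "snd z"] by (simp flip: zero_prod_def)
qed

lemma transpose_g_low:
  fixes F :: "(real ^ 'n::finite) \<times> (real ^ 'n) \<Rightarrow> real"
  assumes "open S" "z \<in> S" "Ck_on 2 S F"
    and "\<And>\<xi>. \<xi> \<noteq> 0 \<Longrightarrow> \<xi> \<bullet> (g_up F z *v \<xi>) > 0"
  shows "transpose (g_low F z) = g_low F z"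
  unfolding g_low_def
  using assms by (intro transpose_matrix_inv posdef_invertible transpose_g_up)

text \<open>Symmetry of g_ij holds on the whole open set \<open>S\<close>, hence passes to its base
  and fibre derivatives. This exchanges the first two terms of the Christoffel symbols, fixes the
  third, and settles the fibre derivative in the second summand of N.\<close>

lemma N_coeff_commute:
  fixes F :: "(real ^ 'n::finite) \<times> (real ^ 'n) \<Rightarrow> real"
  assumes S: "open S" "z \<in> S" and F: "Ck_on 2 S F"
    and pos: "\<And>w \<xi>. w \<in> S \<Longrightarrow> \<xi> \<noteq> 0 \<Longrightarrow> \<xi> \<bullet> (g_up F w *v \<xi>) > 0"
  shows "N_coeff F z i j = N_coeff F z j i"
proof -
  have "frechet_derivative (\<lambda>w. g_low F w $ i $ j) (at z) =
      frechet_derivative (\<lambda>w. g_low F w $ j $ i) (at z)" for i j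
    using S F pos
    by (intro frechet_derivative_cong_eventually eventually_nhds_open[OF S]
        symmetric_matrix_component transpose_g_low[of S]) auto
  then have "d_base k (\<lambda>w. g_low F w $ i $ j) z = d_base k (\<lambda>w. g_low F w $ j $ i) z"
    and fib: "d_fibre k (\<lambda>w. g_low F w $ i $ j) z = d_fibre k (\<lambda>w. g_low F w $ j $ i) z" for i j k
    by (simp_all add: d_base_def d_fibre_def)
  then have "christoffel F z l i j = christoffel F z l j i" for l
    unfolding christoffel_def by (simp add: add.commute)
  then show ?thesis
    unfolding N_coeff_def christoffel_o_def using fib by simp
qed

lemma transpose_G_low:
  assumes "transpose (g_low F z) = g_low F z"
  shows "transpose (G_low v \<alpha> \<beta> F z) = G_low v \<alpha> \<beta> F z"
  using symmetric_matrix_component[OF assms]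
  by (simp add: G_low_def transpose_def vec_eq_iff)

text \<open>The summand with p_i p_j has rank one and contributes the square of a linear
  form.\<close>

lemma G_low_quadratic_form:
  "\<xi> \<bullet> (G_low v \<alpha> \<beta> F z *v \<xi>) =
    1/\<beta> * (\<xi> \<bullet> (g_low F z *v \<xi>)) + v (tau (F z)) / (\<alpha> * \<beta>) * (snd z \<bullet> \<xi>)\<^sup>2"
  unfolding quadratic_form_eq_sum
  by (simp add: G_low_def inner_vec_def power2_eq_square sum_product sum.distrib
      sum_distrib_left distrib_left add_divide_distrib mult_ac)

text \<open>Writing \<open>\<xi>\<close> as g^ij applied to \<open>\<eta>\<close> turns the
  g_ij-form of \<open>\<xi>\<close> into \<open>\<eta> \<bullet> \<xi>\<close>. Cauchy-Schwarz and
  Euler's identity \<open>K2\<close> bound (p . \<xi>)^2 by 2 tau times this number, and the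
  condition on \<alpha> + 2 tau v decides the sign.\<close>

lemma G_low_pos:
  fixes F :: "(real ^ 'n::finite) \<times> (real ^ 'n) \<Rightarrow> real"
  assumes sym: "transpose (g_up F z) = g_up F z"
    and pos: "\<And>\<xi>. \<xi> \<noteq> 0 \<Longrightarrow> \<xi> \<bullet> (g_up F z *v \<xi>) > 0"
    and K2: "(F z)\<^sup>2 = snd z \<bullet> (g_up F z *v snd z)"
    and ab: "\<alpha> > 0" "\<beta> > 0" "\<alpha> + 2 * tau (F z) * v (tau (F z)) > 0"
    and ne: "\<xi> \<noteq> 0"
  shows "\<xi> \<bullet> (G_low v \<alpha> \<beta> F z *v \<xi>) > 0"
proof -
  let ?M = "g_up F z" and ?v = "v (tau (F z))"
  have inv: "invertible ?M"
    using pos by (rule posdef_invertible)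
  define \<eta> where "\<eta> = g_low F z *v \<xi>"
  have M\<eta>: "?M *v \<eta> = \<xi>"
    by (simp add: \<eta>_def g_low_def matrix_vector_mul_assoc matrix_inv_inverse[OF inv])
  then have "\<eta> \<noteq> 0"
    using ne by auto
  then have q: "\<eta> \<bullet> \<xi> > 0"
    using pos[of \<eta>] M\<eta> by simp
  have "(snd z \<bullet> (?M *v \<eta>))\<^sup>2 \<le> (F z)\<^sup>2 * (\<eta> \<bullet> (?M *v \<eta>))"
    unfolding K2 using sym pos by (rule symmetric_posdef_Cauchy_Schwarz)
  then have CS: "(snd z \<bullet> \<xi>)\<^sup>2 \<le> 2 * tau (F z) * (\<eta> \<bullet> \<xi>)"
    by (simp add: M\<eta> tau_def)
  have "\<alpha> * (\<eta> \<bullet> \<xi>) + ?v * (snd z \<bullet> \<xi>)\<^sup>2 > 0"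
  \<comment> \<open>The upper bound \<open>CS\<close> yields a lower bound for \<open>?v\<close>
    times the square when \<open>?v\<close> is negative; otherwise that summand is nonnegative
    anyway.\<close>
  proof (cases "?v \<ge> 0")
    case True
    then show ?thesis
      using ab q by (simp add: add_pos_nonneg)
  next
    case False
    have "0 < (\<alpha> + 2 * tau (F z) * ?v) * (\<eta> \<bullet> \<xi>)"
      using ab q by simp
    also have "\<dots> = \<alpha> * (\<eta> \<bullet> \<xi>) + ?v * (2 * tau (F z) * (\<eta> \<bullet> \<xi>))"
      by (simp add: algebra_simps)
    also have "\<dots> \<le> \<alpha> * (\<eta> \<bullet> \<xi>) + ?v * (snd z \<bullet> \<xi>)\<^sup>2"
      using CS False by (intro add_left_mono mult_left_mono_neg) auto
    finally show ?thesis .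
  qed
  then have "0 < (\<alpha> * (\<eta> \<bullet> \<xi>) + ?v * (snd z \<bullet> \<xi>)\<^sup>2) / (\<alpha> * \<beta>)"
    using ab by simp
  also have "\<dots> = \<xi> \<bullet> (G_low v \<alpha> \<beta> F z *v \<xi>)"
    unfolding G_low_quadratic_form using ab by (simp add: \<eta>_def inner_commute field_simps)
  finally show ?thesis .
qed

section \<open>Components in the adapted frame\<close>

text \<open>The vector of all forms \<delta>p_i. The row product \<open>v*\<close> sums over the
  first index of N, as in \<open>delta_p_form\<close>.\<close>

definition delta_p ::
    "((real ^ 'n::finite) \<times> (real ^ 'n) \<Rightarrow> real) \<Rightarrow> (real ^ 'n) \<times> (real ^ 'n) \<Rightarrow>
     (real ^ 'n) \<times> (real ^ 'n) \<Rightarrow> real ^ 'n" where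
  "delta_p F z e = snd e - fst e v* (\<chi> i j. N_coeff F z i j)"

lemma delta_p_form_eq: "delta_p_form F z i e = delta_p F z e $ i"
  by (simp add: delta_p_form_def delta_p_def vector_matrix_mult_def mult.commute)

lemma linear_delta_p: "linear (delta_p F z)"
  by (rule linearI) (simp_all add: delta_p_def algebra_simps scaleR_vector_matrix_assoc)

lemma delta_frame_sum:
  "fst (\<Sum>k\<in>UNIV. a $ k *\<^sub>R delta_frame F z k) = a"
  "delta_p F z (\<Sum>k\<in>UNIV. a $ k *\<^sub>R delta_frame F z k) = 0"
proof -
  show fst: "fst (\<Sum>k\<in>UNIV. a $ k *\<^sub>R delta_frame F z k) = a"
    by (simp add: fst_sum delta_frame_def flip: vec_eq_sum_axis)
  show "delta_p F z (\<Sum>k\<in>UNIV. a $ k *\<^sub>R delta_frame F z k) = 0"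
    unfolding delta_p_def fst
    by (simp add: snd_sum delta_frame_def vec_eq_iff vector_matrix_mult_def mult.commute)
qed

lemma fibre_frame_sum:
  "fst (\<Sum>k\<in>UNIV. a $ k *\<^sub>R fibre_frame k) = 0"
  "delta_p F z (\<Sum>k\<in>UNIV. a $ k *\<^sub>R fibre_frame k) = a"
  by (simp_all add: delta_p_def fst_sum snd_sum fibre_frame_def flip: vec_eq_sum_axis)

text \<open>\<open>fst e\<close> and \<open>delta_p F z e\<close> are the components of
  \<open>e\<close> in the adapted frame, so identities between vectors are tested there.\<close>

lemma adapted_eqI: "fst e = fst e' \<Longrightarrow> delta_p F z e = delta_p F z e' \<Longrightarrow> e = e'"
  by (simp add: delta_p_def prod_eq_iff)

lemma frame_expansion:
  "e = (\<Sum>k\<in>UNIV. fst e $ k *\<^sub>R delta_frame F z k) + (\<Sum>k\<in>UNIV. delta_p F z e $ k *\<^sub>R fibre_frame k)"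
  by (rule adapted_eqI[of _ _ F z])
    (simp_all add: linear_add[OF linear_delta_p] delta_frame_sum fibre_frame_sum)

text \<open>Horizontal vectors have vertical images and conversely, so the matrix of
  \<open>L\<close> is antidiagonal in blocks. The frame index is the first matrix index, whence the
  row products.\<close>

lemma linear_in_adapted_frame:
  fixes Gl Gu :: "real ^ 'n::finite ^ 'n"
  assumes lin: "linear L"
    and delta: "\<And>i. L (delta_frame F z i) = (\<Sum>k\<in>UNIV. Gl $ i $ k *\<^sub>R fibre_frame k)"
    and fibre: "\<And>i. L (fibre_frame i) = - (\<Sum>k\<in>UNIV. Gu $ i $ k *\<^sub>R delta_frame F z k)"
  shows "fst (L e) = - (delta_p F z e v* Gu)" and "delta_p F z (L e) = fst e v* Gl"
proof -
  \<comment> \<open>\<open>B\<close> and \<open>D\<close> hide the frame sums, so that only their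
    adapted components enter; the sign in \<open>D\<close> makes it the bare horizontal
    combination.\<close>
  define B where "B i = L (delta_frame F z i)" for i
  define D where "D i = - L (fibre_frame i)" for i
  have L: "L e = (\<Sum>i\<in>UNIV. fst e $ i *\<^sub>R B i) - (\<Sum>i\<in>UNIV. delta_p F z e $ i *\<^sub>R D i)"
    by (subst frame_expansion[of e F z])
      (simp add: linear_add[OF lin] linear_sum[OF lin] linear_cmul[OF lin] B_def D_def sum_negf)
  have B: "fst (B i) = 0" "delta_p F z (B i) = Gl $ i" for i
    unfolding B_def delta by (rule fibre_frame_sum)+
  have D: "fst (D i) = Gu $ i" "delta_p F z (D i) = 0" for i
    unfolding D_def fibre minus_minus by (rule delta_frame_sum)+
  show "fst (L e) = - (delta_p F z e v* Gu)"
    unfolding L by (simp add: fst_sum B D vec_eq_iff vector_matrix_mult_def mult.commute)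
  show "delta_p F z (L e) = fst e v* Gl"
    unfolding L by (simp add: linear_diff[OF linear_delta_p] linear_sum[OF linear_delta_p]
        linear_cmul[OF linear_delta_p] B D vec_eq_iff vector_matrix_mult_def mult.commute)
qed

text \<open>The two terms containing N cancel because N is a symmetric matrix: \<delta>p_i wedge
  dx^i equals dp_i wedge dx^i.\<close>

lemma delta_p_symplectic:
  assumes "\<And>i j. N_coeff F z i j = N_coeff F z j i"
  shows "delta_p F z e \<bullet> fst e' - fst e \<bullet> delta_p F z e' = snd e \<bullet> fst e' - fst e \<bullet> snd e'"
proof -
  let ?N = "(\<chi> i j. N_coeff F z i j)"
  have "transpose ?N = ?N"
    using assms by (simp add: transpose_def vec_eq_iff)
  then have "(fst e v* ?N) \<bullet> fst e' = fst e \<bullet> (fst e' v* ?N)"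
    using dot_lmul_matrix[of "fst e" ?N "fst e'"] transpose_matrix_vector[of ?N "fst e'"] by simp
  then show ?thesis
    by (simp add: delta_p_def inner_diff_left inner_diff_right)
qed

section \<open>The charts of the slit cotangent bundle\<close>

text \<open>The facts about charts on which the calculus of tangent vectors rests. No topology on
  the points enters, so the slit cotangent bundle, whose points form a set, is an instance besides
  the base.\<close>

locale differentiable_atlas =
  fixes A :: "('m, 'e::euclidean_space) chart set"
  assumes inj_chart: "c \<in> A \<Longrightarrow> inj_on (snd c) (fst c)"
    and open_overlap: "c \<in> A \<Longrightarrow> c' \<in> A \<Longrightarrow> open (snd c ` (fst c \<inter> fst c'))"
    and transition_differentiable: "c \<in> A \<Longrightarrow> c' \<in> A \<Longrightarrow> u \<in> fst c \<Longrightarrow> u \<in> fst c' \<Longrightarrow>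
      transition c c' differentiable (at (snd c u))"
begin

lemma chart_inv_coord: "c \<in> A \<Longrightarrow> u \<in> fst c \<Longrightarrow> chart_inv c (snd c u) = u"
  by (simp add: chart_inv_def inj_chart)

lemma transition_coord: "c \<in> A \<Longrightarrow> u \<in> fst c \<Longrightarrow> transition c c' (snd c u) = snd c' u"
  by (simp add: transition_def chart_inv_coord)

lemma transition_derivative_self:
  assumes "c \<in> A" "u \<in> fst c"
  shows "frechet_derivative (transition c c) (at (snd c u)) = (\<lambda>e. e)"
proof -
  have "open (snd c ` fst c)"
    using open_overlap[of c c] assms by simp
  then have "frechet_derivative (transition c c) (at (snd c u)) =
      frechet_derivative (\<lambda>y. y) (at (snd c u))"
    using assms
    by (intro frechet_derivative_cong_eventually eventually_nhds_open[of "snd c ` fst c"])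
      (auto simp: transition_coord)
  then show ?thesis
    by simp
qed

text \<open>Chain rule for Jacobians. The direct and the composite transition agree on the image of
  the overlap of \<open>c\<close> and \<open>c'\<close>, which is open, so their germs
  agree.\<close>

lemma transition_derivative_comp:
  assumes A: "c \<in> A" "c' \<in> A" "c'' \<in> A" and u: "u \<in> fst c" "u \<in> fst c'" "u \<in> fst c''"
  shows "frechet_derivative (transition c c'') (at (snd c u)) e =
    frechet_derivative (transition c' c'') (at (snd c' u))
      (frechet_derivative (transition c c') (at (snd c u)) e)"
proof -
  have "frechet_derivative (transition c c'') (at (snd c u)) =
      frechet_derivative (transition c' c'' \<circ> transition c c') (at (snd c u))"
  proof (rule frechet_derivative_cong_eventually, rule eventually_nhds_open)
    show "open (snd c ` (fst c \<inter> fst c'))"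
      using A(1,2) by (rule open_overlap)
    show "snd c u \<in> snd c ` (fst c \<inter> fst c')"
      using u by blast
    show "transition c c'' w = (transition c' c'' \<circ> transition c c') w"
      if "w \<in> snd c ` (fst c \<inter> fst c')" for w
      using that A by (auto simp: transition_coord)
  qed
  also have "\<dots> = frechet_derivative (transition c' c'') (at (transition c c' (snd c u))) \<circ>
      frechet_derivative (transition c c') (at (snd c u))"
    using transition_differentiable[of c c' u] transition_differentiable[of c' c'' u] A u
    by (intro frechet_derivative_compose) (simp_all only: transition_coord)
  finally show ?thesis
    by (simp only: transition_coord[OF A(1) u(1)] o_apply)
qed

lemma coord_vec_self: "c \<in> A \<Longrightarrow> u \<in> fst c \<Longrightarrow> coord_vec A c u e c = e"
  by (simp add: coord_vec_def charts_at_def transition_derivative_self)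

lemma coord_vec_in_tangent_space:
  assumes "c \<in> A" "u \<in> fst c"
  shows "coord_vec A c u e \<in> tangent_space A u"
proof -
  have trans: "coord_vec A c u e c'' =
      frechet_derivative (transition c' c'') (at (snd c' u)) (coord_vec A c u e c')"
    if "c' \<in> charts_at A u" "c'' \<in> charts_at A u" for c' c''
    unfolding coord_vec_def if_P[OF that(1)] if_P[OF that(2)]
    by (rule transition_derivative_comp) (use that assms in \<open>auto simp: charts_at_def\<close>)
  have "coord_vec A c u e c' = 0" if "c' \<notin> charts_at A u" for c'
    using that by (simp add: coord_vec_def)
  with trans show ?thesis
    unfolding tangent_space_def by blast
qed

text \<open>The transformation law determines a tangent vector by one coordinate vector, and the
  normalisation to 0 settles the remaining charts. With \<open>coord_vec_self\<close> this
  identifies tangent vectors with coordinate vectors, so pointwise identities can be checked in one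
  chart.\<close>

lemma coord_vec_of_tangent:
  assumes "c \<in> A" "u \<in> fst c" and X: "X \<in> tangent_space A u"
  shows "coord_vec A c u (X c) = X"
proof
  fix c'
  have c: "c \<in> charts_at A u"
    using assms by (simp add: charts_at_def)
  show "coord_vec A c u (X c) c' = X c'"
  proof (cases "c' \<in> charts_at A u")
    case True
    then have "X c' = frechet_derivative (transition c c') (at (snd c u)) (X c)"
      using X c unfolding tangent_space_def by blast
    then show ?thesis
      using True by (metis coord_vec_def)
  next
    case False
    then have "X c' = 0"
      using X unfolding tangent_space_def by blast
    then show ?thesis
      using False by (simp add: coord_vec_def)
  qed
qed

lemma linear_transition_derivative:
  "c \<in> A \<Longrightarrow> c' \<in> A \<Longrightarrow> u \<in> fst c \<Longrightarrow> u \<in> fst c' \<Longrightarrow>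
    linear (frechet_derivative (transition c c') (at (snd c u)))"
  by (intro linear_frechet_derivative transition_differentiable)

lemma coord_vec_scaleR_add:
  assumes "c \<in> A" "u \<in> fst c"
  shows "coord_vec A c u (a *\<^sub>R e + e') = (\<lambda>c'. a *\<^sub>R coord_vec A c u e c' + coord_vec A c u e' c')"
proof
  fix c'
  show "coord_vec A c u (a *\<^sub>R e + e') c' = a *\<^sub>R coord_vec A c u e c' + coord_vec A c u e' c'"
  proof (cases "c' \<in> charts_at A u")
    case True
    then have "linear (frechet_derivative (transition c c') (at (snd c u)))"
      using assms by (intro linear_transition_derivative) (auto simp: charts_at_def)
    then show ?thesis
      using True by (simp add: coord_vec_def linear_add linear_cmul)
  qed (simp add: coord_vec_def)
qed

end

text \<open>Charts are homeomorphisms onto open sets, so overlaps have open images.\<close>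

lemma smooth_atlas_differentiable_atlas:
  assumes "smooth_atlas A"
  shows "differentiable_atlas A"
proof
  fix c c' u
  assume c: "c \<in> A"
  then have hom: "homeomorphism (fst c) (chart_image c) (snd c) (chart_inv c)"
    and op: "open (fst c)" "open (chart_image c)"
    using assms by (auto simp: smooth_atlas_def)
  show "inj_on (snd c) (fst c)"
    using hom by (metis homeomorphism_def inj_on_inverseI)
  assume c': "c' \<in> A"
  then have "open (fst c')"
    using assms by (auto simp: smooth_atlas_def)
  then have "openin (top_of_set (fst c)) (fst c \<inter> fst c')"
    by (simp add: openin_open_Int)
  then have "openin (top_of_set (chart_image c)) (snd c ` (fst c \<inter> fst c'))"
    by (rule homeomorphism_imp_open_map[OF hom])
  then show "open (snd c ` (fst c \<inter> fst c'))"
    using op(2) by (rule openin_open_trans)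
  assume u: "u \<in> fst c" "u \<in> fst c'"
  have "Ck_on 2 (snd c ` (fst c \<inter> fst c')) (transition c c')"
    using assms c c' unfolding smooth_atlas_def smooth_on_def by blast
  then show "transition c c' differentiable (at (snd c u))"
    using u unfolding Ck_on_2_iff by blast
qed

section \<open>Covectors and induced coordinates\<close>

text \<open>The covector at \<open>x\<close> with components \<open>q\<close> in the chart
  \<open>c\<close>: its components in \<open>c'\<close> arise from \<open>q\<close> by the
  transposed Jacobian of the passage from \<open>c'\<close> back to \<open>c\<close>. The value 0
  elsewhere is the normalisation of \<open>cotangent_space\<close>.\<close>

definition coord_covec ::
    "('m, 'n::finite) base_chart set \<Rightarrow> ('m, 'n) base_chart \<Rightarrow> 'm \<Rightarrow> real ^ 'n \<Rightarrow>
     ('m, 'n) base_chart \<Rightarrow> real ^ 'n" where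
  "coord_covec A c x q = (\<lambda>c'. if c' \<in> charts_at A x
     then (\<chi> i. q \<bullet> frechet_derivative (transition c' c) (at (snd c' x)) (axis i 1)) else 0)"

lemma coord_covec_scaleR: "coord_covec A c x (t *\<^sub>R q) = (\<lambda>c'. t *\<^sub>R coord_covec A c x q c')"
  by (rule ext) (simp add: coord_covec_def vec_eq_iff)

lemma coord_covec_zero: "coord_covec A c x 0 = (\<lambda>c'. 0)"
  by (rule ext) (simp add: coord_covec_def vec_eq_iff)

locale base_atlas =
  fixes A :: "('m::{t2_space, second_countable_topology}, 'n::finite) base_chart set"
  assumes smooth: "smooth_atlas A"
begin

sublocale differentiable_atlas A
  using smooth by (rule smooth_atlas_differentiable_atlas)

lemma inner_coord_covec:
  assumes "c \<in> A" "c' \<in> A" "x \<in> fst c" "x \<in> fst c'"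
  shows "coord_covec A c x q c' \<bullet> e = q \<bullet> frechet_derivative (transition c' c) (at (snd c' x)) e"
proof -
  let ?D = "frechet_derivative (transition c' c) (at (snd c' x))"
  have lin: "linear ?D"
    using assms by (intro linear_transition_derivative)
  have "?D e = (\<Sum>i\<in>UNIV. e $ i *\<^sub>R ?D (axis i 1))"
    by (subst vec_eq_sum_axis[of e]) (simp only: linear_sum[OF lin] linear_cmul[OF lin])
  then show ?thesis
    using assms by (simp add: coord_covec_def charts_at_def inner_vec_def[of _ e] inner_sum_right mult.commute)
qed

lemma coord_covec_self:
  assumes "c \<in> A" "x \<in> fst c"
  shows "coord_covec A c x q c = q"
proof -
  have "coord_covec A c x q c \<bullet> e = q \<bullet> e" for e
    using assms by (simp add: inner_coord_covec transition_derivative_self)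
  then show ?thesis
    using vector_eq_rdot by blast
qed

text \<open>The transformation law is the chain rule for Jacobians, paired with
  \<open>q\<close>.\<close>

lemma coord_covec_in_cotangent_space:
  assumes "c \<in> A" "x \<in> fst c"
  shows "coord_covec A c x q \<in> cotangent_space A x"
proof -
  have trans: "coord_covec A c x q c' \<bullet> e =
      coord_covec A c x q c'' \<bullet> frechet_derivative (transition c' c'') (at (snd c' x)) e"
    if "c' \<in> charts_at A x" "c'' \<in> charts_at A x" for c' c'' e
  proof -
    have c: "c' \<in> A" "x \<in> fst c'" "c'' \<in> A" "x \<in> fst c''"
      using that by (auto simp: charts_at_def)
    show ?thesis
      unfolding inner_coord_covec[OF assms(1) c(1) assms(2) c(2)]
        inner_coord_covec[OF assms(1) c(3) assms(2) c(4)]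
      by (rule arg_cong, rule transition_derivative_comp) (use assms c in auto)
  qed
  have "coord_covec A c x q c' = 0" if "c' \<notin> charts_at A x" for c'
    using that by (simp add: coord_covec_def)
  with trans show ?thesis
    unfolding cotangent_space_def by blast
qed

lemma coord_covec_of_cotangent:
  assumes c: "c \<in> A" "x \<in> fst c" and p: "p \<in> cotangent_space A x"
  shows "coord_covec A c x (p c) = p"
proof
  fix c'
  have cx: "c \<in> charts_at A x"
    using c by (simp add: charts_at_def)
  show "coord_covec A c x (p c) c' = p c'"
  proof (cases "c' \<in> charts_at A x")
    case True
    then have *: "p c' \<bullet> e = p c \<bullet> frechet_derivative (transition c' c) (at (snd c' x)) e" for e
      using cx p unfolding cotangent_space_def by blast
    have "coord_covec A c x (p c) c' $ i = p c' $ i" for i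
      using True *[of "axis i 1"] by (simp add: coord_covec_def inner_axis)
    then show ?thesis
      by (simp add: vec_eq_iff)
  next
    case False
    then have "p c' = 0"
      using p unfolding cotangent_space_def by blast
    then show ?thesis
      using False by (simp add: coord_covec_def)
  qed
qed

lemma coord_covec_in_slit:
  assumes "c \<in> A" "x \<in> fst c" "q \<noteq> 0"
  shows "(x, coord_covec A c x q) \<in> slit_cotangent_bundle A"
proof -
  have "coord_covec A c x q \<noteq> (\<lambda>c. 0)"
    using assms coord_covec_self[of c x q] by metis
  then show ?thesis
    using assms coord_covec_in_cotangent_space by (simp add: slit_cotangent_bundle_def)
qed

text \<open>A covector is recovered from its components in one chart; if these vanish, so does the
  covector.\<close>

lemma slit_coord_nonzero:
  assumes "c \<in> A" "u \<in> slit_cotangent_bundle A" "fst u \<in> fst c"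
  shows "snd u c \<noteq> 0" and "coord_covec A c (fst u) (snd u c) = snd u"
proof -
  show *: "coord_covec A c (fst u) (snd u c) = snd u"
    using assms by (auto simp: slit_cotangent_bundle_def intro: coord_covec_of_cotangent)
  show "snd u c \<noteq> 0"
  proof
    assume "snd u c = 0"
    with * have "snd u = (\<lambda>c. 0)"
      by (simp add: coord_covec_zero)
    then show False
      using assms by (auto simp: slit_cotangent_bundle_def)
  qed
qed

lemma inj_induced_chart:
  assumes "c \<in> A"
  shows "inj_on (snd (induced_chart A c)) (fst (induced_chart A c))"
proof (rule inj_onI)
  fix u u'
  assume u: "u \<in> fst (induced_chart A c)" "u' \<in> fst (induced_chart A c)"
    and eq: "snd (induced_chart A c) u = snd (induced_chart A c) u'"
  have slit: "u \<in> slit_cotangent_bundle A" "fst u \<in> fst c"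
    "u' \<in> slit_cotangent_bundle A" "fst u' \<in> fst c"
    using u by (simp_all add: induced_chart_def)
  have "snd c (fst u) = snd c (fst u')" and cov: "snd u c = snd u' c"
    using eq by (simp_all add: induced_chart_def)
  then have base: "fst u = fst u'"
    using inj_chart[OF assms] slit by (simp add: inj_on_def)
  have "snd u = coord_covec A c (fst u) (snd u c)"
    by (rule slit_coord_nonzero(2)[OF assms slit(1,2), symmetric])
  also have "\<dots> = snd u'"
    unfolding base cov by (rule slit_coord_nonzero(2)[OF assms slit(3,4)])
  finally show "u = u'"
    using base by (simp add: prod_eqI)
qed

text \<open>Fibre coordinates on the slit bundle never vanish, and conversely
  \<open>coord_covec\<close> realises every nonzero vector. The product form makes the image
  open.\<close>

lemma induced_chart_image_overlap:
  assumes c: "c \<in> A"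
  shows "snd (induced_chart A c) ` (fst (induced_chart A c) \<inter> fst (induced_chart A c')) =
    (snd c ` (fst c \<inter> fst c')) \<times> (- {0})"
proof (intro equalityI subsetI)
  fix w
  assume "w \<in> snd (induced_chart A c) ` (fst (induced_chart A c) \<inter> fst (induced_chart A c'))"
  then show "w \<in> (snd c ` (fst c \<inter> fst c')) \<times> (- {0})"
    using slit_coord_nonzero(1)[OF c] by (auto simp: induced_chart_def)
next
  fix w
  assume "w \<in> (snd c ` (fst c \<inter> fst c')) \<times> (- {0} :: (real ^ 'n) set)"
  then obtain x q where x: "x \<in> fst c" "x \<in> fst c'" and q: "q \<noteq> 0" and w: "w = (snd c x, q)"
    by auto
  let ?u = "(x, coord_covec A c x q)"
  have "?u \<in> fst (induced_chart A c) \<inter> fst (induced_chart A c')"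
    using c x q coord_covec_in_slit by (simp add: induced_chart_def)
  moreover have "w = snd (induced_chart A c) ?u"
    using c x w by (simp add: induced_chart_def coord_covec_self)
  ultimately show "w \<in> snd (induced_chart A c) ` (fst (induced_chart A c) \<inter> fst (induced_chart A c'))"
    by blast
qed

lemma chart_image_induced_chart:
  "c \<in> A \<Longrightarrow> chart_image (induced_chart A c) = chart_image c \<times> (- {0})"
  using induced_chart_image_overlap[of c c] by (simp add: chart_image_def)

lemma chart_inv_induced_chart:
  assumes "c \<in> A" "x \<in> fst c" "q \<noteq> 0"
  shows "chart_inv (induced_chart A c) (snd c x, q) = (x, coord_covec A c x q)"
proof -
  have "inv_into (fst (induced_chart A c)) (snd (induced_chart A c))
      (snd (induced_chart A c) (x, coord_covec A c x q)) = (x, coord_covec A c x q)"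
    using assms coord_covec_in_slit inj_induced_chart[of c]
    by (intro inv_into_f_f) (auto simp: induced_chart_def)
  then show ?thesis
    using assms by (simp add: chart_inv_def induced_chart_def coord_covec_self)
qed

text \<open>The fibre part is \<open>q\<close> under the transposed Jacobian of the inverse base
  transition, taken at the image point. It is spelled out over the standard basis so that
  differentiability can be read off term by term.\<close>

lemma transition_induced_chart:
  assumes "c \<in> A" "c' \<in> A" "y \<in> snd c ` (fst c \<inter> fst c')" "q \<noteq> 0"
  shows "transition (induced_chart A c) (induced_chart A c') (y, q) = (transition c c' y,
    \<Sum>i\<in>UNIV. (q \<bullet> frechet_derivative (transition c' c) (at (transition c c' y)) (axis i 1)) *\<^sub>R axis i 1)"
proof -
  obtain x where x: "x \<in> fst c" "x \<in> fst c'" "y = snd c x"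
    using assms(3) by auto
  have "transition (induced_chart A c) (induced_chart A c') (y, q) = (snd c' x, coord_covec A c x q c')"
    using assms x by (simp add: transition_def chart_inv_induced_chart)
      (simp add: induced_chart_def)
  then show ?thesis
    using assms x
    by (subst (asm) vec_eq_sum_axis) (simp add: transition_coord coord_covec_def charts_at_def)
qed

text \<open>The Jacobian of a base transition occurs in the fibre part, so one derivative on the
  bundle costs two on the base; the C^2 property of \<open>transition c' c\<close> supplies
  them.\<close>

lemma transition_induced_chart_differentiable:
  assumes c: "c \<in> A" "c' \<in> A" and w: "w \<in> (snd c ` (fst c \<inter> fst c')) \<times> (- {0})"
  shows "transition (induced_chart A c) (induced_chart A c') differentiable (at w)"
proof -
  let ?S = "snd c ` (fst c \<inter> fst c')"
  let ?\<phi> = "transition c c'"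
  let ?D = "\<lambda>i y. frechet_derivative (transition c' c) (at y) (axis i 1)"
  have "fst w \<in> ?S"
    using w by (simp add: mem_Times_iff)
  then obtain x where x: "x \<in> fst c" "x \<in> fst c'" "fst w = snd c x"
    by blast
  have \<phi>: "?\<phi> differentiable (at (fst w))"
    using c x by (simp add: transition_differentiable)
  have "Ck_on 2 (snd c' ` (fst c' \<inter> fst c)) (transition c' c)"
    using smooth c unfolding smooth_atlas_def smooth_on_def by blast
  moreover have "?\<phi> (fst w) \<in> snd c' ` (fst c' \<inter> fst c)"
    using c x by (auto simp: transition_coord)
  ultimately have D: "?D i differentiable (at (?\<phi> (fst w)))" for i
    unfolding Ck_on_2_iff by blast
  have fst_diff: "fst differentiable (at w)" and snd_diff: "snd differentiable (at w)"
    by (auto simp: differentiable_def intro: bounded_linear_imp_has_derivative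
        bounded_linear_fst bounded_linear_snd)
  have \<phi>w: "(\<lambda>w. ?\<phi> (fst w)) differentiable (at w)"
    using differentiable_chain_at[OF fst_diff \<phi>] by (simp add: o_def)
  have Dw: "(\<lambda>w. ?D i (?\<phi> (fst w))) differentiable (at w)" for i
    using differentiable_chain_at[OF \<phi>w D] by (simp add: o_def)
  let ?T = "\<lambda>w. (?\<phi> (fst w), \<Sum>i\<in>UNIV. (snd w \<bullet> ?D i (?\<phi> (fst w))) *\<^sub>R axis i (1::real))"
  have "?T differentiable (at w)"
    using \<phi>w Dw snd_diff
    by (intro differentiable_Pair differentiable_sum ballI differentiable_scaleR
        differentiable_inner differentiable_const) auto
  then obtain T' where "(?T has_derivative T') (at w)"
    by (auto simp: differentiable_def)
  moreover have "open (?S \<times> (- {0} :: (real ^ 'n) set))"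
    using c by (intro open_Times open_overlap) auto
  moreover note w
  moreover have "?T w' = transition (induced_chart A c) (induced_chart A c') w'"
    if "w' \<in> ?S \<times> (- {0})" for w'
    using transition_induced_chart[OF c, of "fst w'" "snd w'"] that
    by (simp only: mem_Times_iff Compl_iff singleton_iff prod.collapse not_False_eq_True)
  ultimately have "(transition (induced_chart A c) (induced_chart A c') has_derivative T') (at w)"
    by (rule has_derivative_transform_within_open)
  then show ?thesis
    by (auto simp: differentiable_def)
qed

lemma differentiable_slit_atlas: "differentiable_atlas (slit_atlas A)"
proof
  fix C C' u
  assume "C \<in> slit_atlas A"
  then obtain c where c: "c \<in> A" "C = induced_chart A c"
    by (auto simp: slit_atlas_def)
  then show "inj_on (snd C) (fst C)"
    by (simp add: inj_induced_chart)
  assume "C' \<in> slit_atlas A"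
  then obtain c' where c': "c' \<in> A" "C' = induced_chart A c'"
    by (auto simp: slit_atlas_def)
  show "open (snd C ` (fst C \<inter> fst C'))"
    unfolding c c' induced_chart_image_overlap[OF c(1)]
    using c(1) c'(1) by (intro open_Times open_overlap) auto
  assume "u \<in> fst C" "u \<in> fst C'"
  then have "snd C u \<in> snd C ` (fst C \<inter> fst C')"
    by blast
  then show "transition C C' differentiable (at (snd C u))"
    unfolding c c' induced_chart_image_overlap[OF c(1)]
    by (rule transition_induced_chart_differentiable[OF c(1) c'(1)])
qed

end

section \<open>The almost Kaehlerian structure\<close>

text \<open>The local formulas give the values of \<open>G\<close> on tangent vectors and of
  \<open>J\<close> on the adapted frame; \<open>bilinear\<close> and \<open>endomorphism\<close>
  supply smoothness, and for \<open>J\<close> also the linearity that extends it to all tangent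
  vectors.\<close>

locale cartan_almost_hermitian =
  fixes A :: "('m::{t2_space, second_countable_topology}, 'n::finite) base_chart set"
    and K :: "('m, 'n) cotangent \<Rightarrow> real"
    and v :: "real \<Rightarrow> real" and \<alpha> \<beta> :: real
    and G :: "('m, 'n) cotangent \<Rightarrow>
        (('m, 'n) cotangent_chart \<Rightarrow> (real ^ 'n) \<times> (real ^ 'n)) \<Rightarrow>
        (('m, 'n) cotangent_chart \<Rightarrow> (real ^ 'n) \<times> (real ^ 'n)) \<Rightarrow> real"
    and J :: "('m, 'n) cotangent \<Rightarrow>
        (('m, 'n) cotangent_chart \<Rightarrow> (real ^ 'n) \<times> (real ^ 'n)) \<Rightarrow>
        (('m, 'n) cotangent_chart \<Rightarrow> (real ^ 'n) \<times> (real ^ 'n))"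
  assumes cartan: "cartan_space A K"
    and alpha: "\<alpha> > 0" and beta: "\<beta> > 0"
    and positive: "\<And>u. u \<in> slit_cotangent_bundle A \<Longrightarrow> \<alpha> + 2 * tau (K u) * v (tau (K u)) > 0"
    and bilinear: "bilinear_field (slit_atlas A) G"
    and metric: "metric_given_by A K v \<alpha> \<beta> G"
    and endomorphism: "endomorphism_field (slit_atlas A) J"
    and complex: "complex_structure_given_by A K v \<alpha> \<beta> J"
begin

sublocale base_atlas A
  using cartan by unfold_locales (simp add: cartan_space_def)

sublocale slit: differentiable_atlas "slit_atlas A"
  by (rule differentiable_slit_atlas)

abbreviation (input) "ind \<equiv> induced_chart A"
abbreviation (input) "coord c u \<equiv> snd (induced_chart A c) u"
abbreviation (input) "F c \<equiv> local_K A K c"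
abbreviation (input) "V c u \<equiv> coord_vec (slit_atlas A) (induced_chart A c) u"
abbreviation (input) "Gl c u \<equiv> G_low v \<alpha> \<beta> (local_K A K c) (snd (induced_chart A c) u)"
abbreviation (input) "Gu c u \<equiv> G_up v \<alpha> \<beta> (local_K A K c) (snd (induced_chart A c) u)"
abbreviation (input) "P c u \<equiv> delta_p (local_K A K c) (snd (induced_chart A c) u)"

lemma ind_in_slit_atlas: "c \<in> A \<Longrightarrow> ind c \<in> slit_atlas A"
  by (simp add: slit_atlas_def)

lemma open_chart_image_ind: "c \<in> A \<Longrightarrow> open (chart_image (ind c))"
  using slit.open_overlap[of "ind c" "ind c"] by (simp add: ind_in_slit_atlas chart_image_def)

lemma coord_in_chart_image: "u \<in> fst (ind c) \<Longrightarrow> coord c u \<in> chart_image (ind c)"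
  by (simp add: chart_image_def)

lemma local_K_coord: "c \<in> A \<Longrightarrow> u \<in> fst (ind c) \<Longrightarrow> F c (coord c u) = K u"
  by (simp add: local_K_def slit.chart_inv_coord ind_in_slit_atlas)

lemma local_K_C2: "c \<in> A \<Longrightarrow> Ck_on 2 (chart_image (ind c)) (F c)"
  using cartan ind_in_slit_atlas
  unfolding cartan_space_def smooth_function_def smooth_on_def local_K_def by blast

lemma g_up_pos:
  "c \<in> A \<Longrightarrow> z \<in> chart_image (ind c) \<Longrightarrow> \<xi> \<noteq> 0 \<Longrightarrow> \<xi> \<bullet> (g_up (F c) z *v \<xi>) > 0"
  using cartan unfolding cartan_space_def by blast

text \<open>Scaling a covector scales its components in every chart by the same factor, so
  homogeneity of \<open>K\<close> on the bundle passes to coordinates. The chart image contains the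
  whole open ray, since its fibre part consists of all nonzero vectors.\<close>

lemma local_K_homogeneous:
  assumes c: "c \<in> A" and z: "z \<in> chart_image (ind c)" and t: "t > 0"
  shows "(fst z, t *\<^sub>R snd z) \<in> chart_image (ind c) \<and> F c (fst z, t *\<^sub>R snd z) = t * F c z"
proof -
  have "fst z \<in> snd c ` fst c" and q: "snd z \<noteq> 0"
    using z unfolding chart_image_induced_chart[OF c] chart_image_def[of c] by auto
  then obtain x where x: "x \<in> fst c" "fst z = snd c x"
    by blast
  let ?p = "coord_covec A c x (snd z)"
  have hom: "\<forall>(x, p)\<in>cotangent_bundle A. \<forall>t>0. K (x, \<lambda>c. t *\<^sub>R p c) = t * K (x, p)"
    using cartan unfolding cartan_space_def by blast
  have "(x, ?p) \<in> cotangent_bundle A"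
    using coord_covec_in_cotangent_space[OF c x(1)] by (simp add: cotangent_bundle_def)
  from bspec[OF hom this] have "K (x, \<lambda>c. t *\<^sub>R ?p c) = t * K (x, ?p)"
    using t by simp
  moreover have "chart_inv (ind c) z = (x, ?p)"
    using chart_inv_induced_chart[OF c x(1) q] x(2) by (metis prod.collapse)
  moreover have "chart_inv (ind c) (fst z, t *\<^sub>R snd z) = (x, \<lambda>c. t *\<^sub>R ?p c)"
    using chart_inv_induced_chart[OF c x(1), of "t *\<^sub>R snd z"] x(2) q t
    by (simp add: coord_covec_scaleR)
  moreover have "(fst z, t *\<^sub>R snd z) \<in> chart_image (ind c)"
    using z q t unfolding chart_image_induced_chart[OF c] by auto
  ultimately show ?thesis
    by (simp add: local_K_def)
qed

lemma N_coeff_symmetric: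
  assumes "c \<in> A" "u \<in> fst (ind c)"
  shows "N_coeff (F c) (coord c u) i j = N_coeff (F c) (coord c u) j i"
  using assms
  by (intro N_coeff_commute[of "chart_image (ind c)"] open_chart_image_ind coord_in_chart_image
      local_K_C2 g_up_pos)

lemma transpose_Gl:
  assumes "c \<in> A" "u \<in> fst (ind c)"
  shows "transpose (Gl c u) = Gl c u"
  using assms
  by (intro transpose_G_low transpose_g_low[of "chart_image (ind c)"] open_chart_image_ind
      coord_in_chart_image local_K_C2 g_up_pos)

lemma Gl_pos:
  assumes c: "c \<in> A" "u \<in> fst (ind c)" and "\<xi> \<noteq> 0"
  shows "\<xi> \<bullet> (Gl c u *v \<xi>) > 0"
proof (rule G_low_pos)
  note S = open_chart_image_ind[OF c(1)] coord_in_chart_image[OF c(2)] local_K_C2[OF c(1)]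
  show "transpose (g_up (F c) (coord c u)) = g_up (F c) (coord c u)"
    by (rule transpose_g_up[OF S])
  show "\<xi> \<bullet> (g_up (F c) (coord c u) *v \<xi>) > 0" if "\<xi> \<noteq> 0" for \<xi>
    using c(1) S(2) that by (rule g_up_pos)
  show "(F c (coord c u))\<^sup>2 = snd (coord c u) \<bullet> (g_up (F c) (coord c u) *v snd (coord c u))"
    by (rule square_eq_g_up[OF S]) (rule local_K_homogeneous[OF c(1) S(2)])
  show "\<alpha> + 2 * tau (F c (coord c u)) * v (tau (F c (coord c u))) > 0"
    using positive[of u] c by (simp add: local_K_coord) (simp add: induced_chart_def)
qed (use alpha beta \<open>\<xi> \<noteq> 0\<close> in auto)

lemma Gu_Gl:
  assumes "c \<in> A" "u \<in> fst (ind c)"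
  shows "Gu c u ** Gl c u = mat 1" "Gl c u ** Gu c u = mat 1"
  unfolding G_up_def using Gl_pos[OF assms] by (auto intro!: matrix_inv_inverse posdef_invertible)

lemma transpose_Gu:
  assumes "c \<in> A" "u \<in> fst (ind c)"
  shows "transpose (Gu c u) = Gu c u"
  unfolding G_up_def using Gl_pos[OF assms] transpose_Gl[OF assms]
  by (auto intro!: transpose_matrix_inv posdef_invertible)

lemma Gu_pos:
  assumes "c \<in> A" "u \<in> fst (ind c)" "\<xi> \<noteq> 0"
  shows "\<xi> \<bullet> (Gu c u *v \<xi>) > 0"
  unfolding G_up_def
  using transpose_Gl[OF assms(1,2)] Gl_pos[OF assms(1,2)] assms(3)
  by (rule symmetric_posdef_matrix_inv)

lemma V_tangent: "c \<in> A \<Longrightarrow> u \<in> fst (ind c) \<Longrightarrow> V c u e \<in> tangent_space (slit_atlas A) u"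
  by (rule slit.coord_vec_in_tangent_space[OF ind_in_slit_atlas])

lemma V_self: "c \<in> A \<Longrightarrow> u \<in> fst (ind c) \<Longrightarrow> V c u e (ind c) = e"
  by (rule slit.coord_vec_self[OF ind_in_slit_atlas])

lemma V_of_tangent:
  "c \<in> A \<Longrightarrow> u \<in> fst (ind c) \<Longrightarrow> X \<in> tangent_space (slit_atlas A) u \<Longrightarrow> V c u (X (ind c)) = X"
  by (rule slit.coord_vec_of_tangent[OF ind_in_slit_atlas])

section \<open>\<open>G\<close> and \<open>J\<close> in adapted components\<close>

lemma metric_in_chart:
  assumes "c \<in> A" "u \<in> fst (ind c)" "X \<in> tangent_space (slit_atlas A) u" "Y \<in> tangent_space (slit_atlas A) u"
  shows "G u X Y = fst (X (ind c)) \<bullet> (Gl c u *v fst (Y (ind c)))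
    + P c u (X (ind c)) \<bullet> (Gu c u *v P c u (Y (ind c)))"
  using metric[unfolded metric_given_by_def Let_def dx_form_def delta_p_form_eq
      quadratic_form_eq_sum[symmetric]] assms by blast

text \<open>The endomorphism \<open>J u\<close> carried to coordinate vectors by the identification
  \<open>V c u\<close>, so that matrix algebra applies.\<close>

definition J_coord ::
    "('m, 'n) base_chart \<Rightarrow> ('m, 'n) cotangent \<Rightarrow> (real ^ 'n) \<times> (real ^ 'n) \<Rightarrow> (real ^ 'n) \<times> (real ^ 'n)"
  where "J_coord c u e = J u (V c u e) (ind c)"

lemma slit_carrier: "c \<in> A \<Longrightarrow> u \<in> fst (ind c) \<Longrightarrow> u \<in> atlas_carrier (slit_atlas A)"
  unfolding atlas_carrier_def using ind_in_slit_atlas by blast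

lemma slit_carrierE:
  assumes "u \<in> atlas_carrier (slit_atlas A)"
  obtains c where "c \<in> A" "u \<in> fst (ind c)"
  using assms by (auto simp: atlas_carrier_def slit_atlas_def)

lemma J_tangent:
  assumes "u \<in> atlas_carrier (slit_atlas A)" "X \<in> tangent_space (slit_atlas A) u"
  shows "J u X \<in> tangent_space (slit_atlas A) u"
  using endomorphism assms unfolding endomorphism_field_def by blast

lemma J_in_chart:
  assumes c: "c \<in> A" "u \<in> fst (ind c)" and X: "X \<in> tangent_space (slit_atlas A) u"
  shows "J u X (ind c) = J_coord c u (X (ind c))"
  unfolding J_coord_def V_of_tangent[OF c X] ..

lemma linear_J_coord:
  assumes c: "c \<in> A" "u \<in> fst (ind c)"
  shows "linear (J_coord c u)"
proof -
  have J: "J_coord c u (a *\<^sub>R e + e') = a *\<^sub>R J_coord c u e + J_coord c u e'" for a e e'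
    using endomorphism slit_carrier[OF c] V_tangent[OF c, of e] V_tangent[OF c, of e']
      slit.coord_vec_scaleR_add[OF ind_in_slit_atlas[OF c(1)] c(2), of a e e']
    unfolding endomorphism_field_def J_coord_def by simp
  \<comment> \<open>At zero arguments the rule \<open>J\<close> says that the value equals twice
    itself.\<close>
  have "J_coord c u 0 = 0"
    using J[of 1 0 0] by simp
  then show ?thesis
    using J[of 1] J[of _ _ 0] by (intro linearI) auto
qed

text \<open>\<open>J\<close> exchanges horizontal and vertical parts; symmetry of \<open>Gl\<close>
  and \<open>Gu\<close> turns the row products into column products.\<close>

lemma J_coord_adapted:
  assumes c: "c \<in> A" "u \<in> fst (ind c)"
  shows "fst (J_coord c u e) = - (Gu c u *v P c u e)" "P c u (J_coord c u e) = Gl c u *v fst e"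
proof -
  have "J_coord c u (delta_frame (F c) (coord c u) i) = (\<Sum>k\<in>UNIV. Gl c u $ i $ k *\<^sub>R fibre_frame k)"
    and "J_coord c u (fibre_frame i) = - (\<Sum>k\<in>UNIV. Gu c u $ i $ k *\<^sub>R delta_frame (F c) (coord c u) k)" for i
    using complex c unfolding complex_structure_given_by_def Let_def J_coord_def
    by (simp_all add: V_self)
  note L = linear_in_adapted_frame[OF linear_J_coord[OF c] this]
  show "fst (J_coord c u e) = - (Gu c u *v P c u e)"
    using L(1)[of e] transpose_matrix_vector[of "Gu c u"] transpose_Gu[OF c] by simp
  show "P c u (J_coord c u e) = Gl c u *v fst e"
    using L(2)[of e] transpose_matrix_vector[of "Gl c u"] transpose_Gl[OF c] by simp
qed

text \<open>Applying the antidiagonal blocks twice produces the products of \<open>Gu\<close> and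
  \<open>Gl\<close>, which are identities, each with exactly one sign.\<close>

lemma J_J:
  assumes u: "u \<in> atlas_carrier (slit_atlas A)" and X: "X \<in> tangent_space (slit_atlas A) u"
  shows "J u (J u X) = (\<lambda>c. - X c)"
proof -
  obtain c where c: "c \<in> A" "u \<in> fst (ind c)"
    using u by (rule slit_carrierE)
  have JX: "J u X \<in> tangent_space (slit_atlas A) u"
    using u X by (rule J_tangent)
  have "J_coord c u (J_coord c u e) = - e" for e
    by (rule adapted_eqI[of _ _ "F c" "coord c u"])
      (simp_all add: J_coord_adapted[OF c] matrix_vector_mult_minus matrix_vector_mul_assoc Gu_Gl[OF c] linear_neg[OF linear_delta_p]
        flip: vector_matrix_mul_assoc)
  \<comment> \<open>The negative is written as a linear combination to match
    \<open>coord_vec_scaleR_add\<close>, which carries it from the chart \<open>c\<close> to all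
    others.\<close>
  then have "J u (J u X) (ind c) = (-1) *\<^sub>R X (ind c) + 0"
    by (simp add: J_in_chart[OF c JX] J_in_chart[OF c X])
  then have "J u (J u X) = V c u ((-1) *\<^sub>R X (ind c) + 0)"
    using V_of_tangent[OF c J_tangent[OF u JX]] by simp
  moreover have "V c u 0 = (\<lambda>c'. 0)"
    using slit.coord_vec_scaleR_add[OF ind_in_slit_atlas[OF c(1)] c(2), of 1 0 0] by (simp add: fun_eq_iff)
  ultimately show ?thesis
    unfolding slit.coord_vec_scaleR_add[OF ind_in_slit_atlas[OF c(1)] c(2)] V_of_tangent[OF c X]
    by simp
qed

text \<open>The blocks of \<open>J\<close> cancel against those of \<open>G\<close>, as
  \<open>Gl\<close> and \<open>Gu\<close> are mutually inverse. What remains is \<delta>p_i wedge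
  dx^i, and symmetry of N replaces \<delta>p_i by dp_i.\<close>

lemma fundamental_form_in_chart:
  assumes c: "c \<in> A" "u \<in> fst (ind c)"
    and X: "X \<in> tangent_space (slit_atlas A) u" and Y: "Y \<in> tangent_space (slit_atlas A) u"
  shows "fundamental_form G J u X Y =
    snd (X (ind c)) \<bullet> fst (Y (ind c)) - fst (X (ind c)) \<bullet> snd (Y (ind c))"
proof -
  have JY: "J u Y \<in> tangent_space (slit_atlas A) u"
    using slit_carrier[OF c] Y by (rule J_tangent)
  have "fundamental_form G J u X Y =
      P c u (X (ind c)) \<bullet> fst (Y (ind c)) - fst (X (ind c)) \<bullet> P c u (Y (ind c))"
    by (simp add: fundamental_form_def metric_in_chart[OF c X JY] J_in_chart[OF c Y]
        J_coord_adapted[OF c] matrix_vector_mul_assoc Gu_Gl[OF c] matrix_vector_mult_minus)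
  then show ?thesis
    using delta_p_symplectic[OF N_coeff_symmetric[OF c]] by simp
qed

text \<open>\<open>J\<close> interchanges the two blocks: the horizontal part of J X is
  -\<open>Gu\<close> applied to the vertical part of X, so \<open>Gl\<close> evaluated on such
  vectors gives \<open>Gu\<close>, and vice versa.\<close>

lemma hermitian:
  assumes u: "u \<in> atlas_carrier (slit_atlas A)"
    and X: "X \<in> tangent_space (slit_atlas A) u" and Y: "Y \<in> tangent_space (slit_atlas A) u"
  shows "G u (J u X) (J u Y) = G u X Y"
proof -
  obtain c where c: "c \<in> A" "u \<in> fst (ind c)"
    using u by (rule slit_carrierE)
  have sym: "(M *v a) \<bullet> b = a \<bullet> (M *v b)" if "transpose M = M" for M :: "real ^ 'n ^ 'n" and a b
    using dot_lmul_matrix[of a M b] transpose_matrix_vector[of M a] that by simp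
  show ?thesis
    unfolding metric_in_chart[OF c J_tangent[OF u X] J_tangent[OF u Y]] metric_in_chart[OF c X Y]
    by (simp add: J_in_chart[OF c X] J_in_chart[OF c Y] J_coord_adapted[OF c]
        sym[OF transpose_Gl[OF c]] sym[OF transpose_Gu[OF c]] matrix_vector_mul_assoc Gu_Gl[OF c]
        matrix_vector_mult_minus)
qed

lemma symmetric_G:
  assumes u: "u \<in> atlas_carrier (slit_atlas A)"
    and X: "X \<in> tangent_space (slit_atlas A) u" and Y: "Y \<in> tangent_space (slit_atlas A) u"
  shows "G u X Y = G u Y X"
proof -
  obtain c where c: "c \<in> A" "u \<in> fst (ind c)"
    using u by (rule slit_carrierE)
  have sym: "a \<bullet> (M *v b) = b \<bullet> (M *v a)" if "transpose M = M" for M :: "real ^ 'n ^ 'n" and a b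
    using dot_lmul_matrix[of a M b] transpose_matrix_vector[of M a] that by (simp add: inner_commute)
  show ?thesis
    unfolding metric_in_chart[OF c X Y] metric_in_chart[OF c Y X]
    using sym transpose_Gl[OF c] transpose_Gu[OF c] by metis
qed

text \<open>A nonzero tangent vector has nonzero coordinates in one chart, hence a nonzero adapted
  component; its block contributes a positive summand and the other block a nonnegative one.\<close>

lemma positive_G:
  assumes u: "u \<in> atlas_carrier (slit_atlas A)"
    and X: "X \<in> tangent_space (slit_atlas A) u" and ne: "X \<noteq> (\<lambda>c. 0)"
  shows "G u X X > 0"
proof -
  obtain c where c: "c \<in> A" "u \<in> fst (ind c)"
    using u by (rule slit_carrierE)
  have "V c u 0 = (\<lambda>c'. 0)"
    using slit.coord_vec_scaleR_add[OF ind_in_slit_atlas[OF c(1)] c(2), of 1 0 0] by (simp add: fun_eq_iff)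
  then have "X (ind c) \<noteq> 0"
    using V_of_tangent[OF c X] ne by auto
  then have "fst (X (ind c)) \<noteq> 0 \<or> P c u (X (ind c)) \<noteq> 0"
    using adapted_eqI[of "X (ind c)" 0 "F c" "coord c u"] by (auto simp: linear_0[OF linear_delta_p])
  moreover have "a \<bullet> (Gl c u *v a) \<ge> 0" "a \<bullet> (Gu c u *v a) \<ge> 0" for a
    using Gl_pos[OF c, of a] Gu_pos[OF c, of a] by (cases "a = 0"; simp add: less_imp_le)+
  ultimately show ?thesis
    unfolding metric_in_chart[OF c X X]
    using Gl_pos[OF c, of "fst (X (ind c))"] Gu_pos[OF c, of "P c u (X (ind c))"]
    by (auto intro: add_pos_nonneg add_nonneg_pos)
qed

section \<open>Closedness of the fundamental form\<close>

text \<open>The coefficients of dp_i wedge dx^i on constant vectors are independent of the point;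
  both smoothness and closedness are read off from this.\<close>

lemma form_in_chart_fundamental_form:
  assumes c: "c \<in> A" and z: "z \<in> chart_image (ind c)"
  shows "form_in_chart (slit_atlas A) (fundamental_form G J) (ind c) a b z = snd a \<bullet> fst b - fst a \<bullet> snd b"
proof -
  obtain u where u: "u \<in> fst (ind c)" "z = coord c u"
    using z by (auto simp: chart_image_def)
  then have inv: "chart_inv (ind c) z = u"
    by (simp add: slit.chart_inv_coord ind_in_slit_atlas c)
  show ?thesis
    unfolding form_in_chart_def inv
    by (simp add: fundamental_form_in_chart[OF c u(1)] V_tangent[OF c u(1)] V_self[OF c u(1)])
qed

text \<open>The combination is the tangent vector whose coordinates in one chart are the combined
  ones.\<close>

lemma tangent_scaleR_add:
  assumes u: "u \<in> atlas_carrier (slit_atlas A)"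
    and X: "X \<in> tangent_space (slit_atlas A) u" and Y: "Y \<in> tangent_space (slit_atlas A) u"
  shows "(\<lambda>c. a *\<^sub>R X c + Y c) \<in> tangent_space (slit_atlas A) u"
proof -
  obtain c where c: "c \<in> A" "u \<in> fst (ind c)"
    using u by (rule slit_carrierE)
  show ?thesis
    using V_tangent[OF c, of "a *\<^sub>R X (ind c) + Y (ind c)"]
    unfolding slit.coord_vec_scaleR_add[OF ind_in_slit_atlas[OF c(1)] c(2)]
      V_of_tangent[OF c X] V_of_tangent[OF c Y] .
qed

lemma two_form_fundamental_form: "two_form (slit_atlas A) (fundamental_form G J)"
proof -
  let ?\<theta> = "fundamental_form G J"
  have "?\<theta> u (\<lambda>c. a *\<^sub>R X c + Y c) Z = a * ?\<theta> u X Z + ?\<theta> u Y Z \<and>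
      ?\<theta> u Z (\<lambda>c. a *\<^sub>R X c + Y c) = a * ?\<theta> u Z X + ?\<theta> u Z Y"
    if u: "u \<in> atlas_carrier (slit_atlas A)" and X: "X \<in> tangent_space (slit_atlas A) u"
      and Y: "Y \<in> tangent_space (slit_atlas A) u" and Z: "Z \<in> tangent_space (slit_atlas A) u"
    for u X Y Z a
  proof -
    obtain c where c: "c \<in> A" "u \<in> fst (ind c)"
      using u by (rule slit_carrierE)
    note XY = tangent_scaleR_add[OF u X Y, of a]
    show ?thesis
      unfolding fundamental_form_in_chart[OF c XY Z] fundamental_form_in_chart[OF c Z XY]
        fundamental_form_in_chart[OF c X Z] fundamental_form_in_chart[OF c Z X]
        fundamental_form_in_chart[OF c Y Z] fundamental_form_in_chart[OF c Z Y]
      by (simp add: inner_add_left inner_add_right algebra_simps)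
  qed
  moreover have "smooth_on (chart_image C) (\<lambda>z. ?\<theta> (chart_inv C z)
      (coord_vec (slit_atlas A) C (chart_inv C z) a) (coord_vec (slit_atlas A) C (chart_inv C z) b))"
    if C: "C \<in> slit_atlas A" for C a b
  proof -
    obtain c where c: "c \<in> A" "C = ind c"
      using C by (auto simp: slit_atlas_def)
    \<comment> \<open>Every coefficient is a constant function on the open chart image.\<close>
    show ?thesis
      unfolding smooth_on_def c(2)
      by (intro allI Ck_on_constant[OF open_chart_image_ind[OF c(1)]])
        (rule form_in_chart_fundamental_form[OF c(1), unfolded form_in_chart_def])
  qed
  moreover have "?\<theta> u X X = 0"
    if u: "u \<in> atlas_carrier (slit_atlas A)" and X: "X \<in> tangent_space (slit_atlas A) u" for u X
  proof -
    obtain c where c: "c \<in> A" "u \<in> fst (ind c)"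
      using u by (rule slit_carrierE)
    show ?thesis
      unfolding fundamental_form_in_chart[OF c X X] by (simp add: inner_commute)
  qed
  ultimately show ?thesis
    unfolding two_form_def bilinear_field_def by blast
qed

text \<open>Each term of \<open>exterior_derivative\<close> differentiates a coefficient that is
  constant near \<open>z\<close>.\<close>

lemma closed_fundamental_form: "closed_two_form (slit_atlas A) (fundamental_form G J)"
proof -
  have "exterior_derivative (slit_atlas A) (fundamental_form G J) C z a b d = 0"
    if C: "C \<in> slit_atlas A" and z: "z \<in> chart_image C" for C z a b d
  proof -
    obtain c where c: "c \<in> A" "C = ind c"
      using C by (auto simp: slit_atlas_def)
    have "frechet_derivative (form_in_chart (slit_atlas A) (fundamental_form G J) C e e') (at z) =
        frechet_derivative (\<lambda>z. snd e \<bullet> fst e' - fst e \<bullet> snd e') (at z)" for e e'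
      using c z open_chart_image_ind form_in_chart_fundamental_form
      by (intro frechet_derivative_cong_eventually eventually_nhds_open[of "chart_image C"]) auto
    then show ?thesis
      by (simp add: exterior_derivative_def)
  qed
  then show ?thesis
    using two_form_fundamental_form unfolding closed_two_form_def by blast
qed

lemma almost_kaehlerian: "almost_kaehlerian (slit_atlas A) G J"
  unfolding almost_kaehlerian_def riemannian_metric_def almost_complex_structure_def vector_field_def
  using bilinear endomorphism symmetric_G positive_G J_J hermitian closed_fundamental_form by blast

end

theorem theorem3p1:
  fixes A :: "('m::{t2_space, second_countable_topology}, 'n::finite) base_chart set"
    and K :: "('m, 'n) cotangent \<Rightarrow> real"
    and v :: "real \<Rightarrow> real" and \<alpha> \<beta> :: real
    and G :: "('m, 'n) cotangent \<Rightarrow>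
        (('m, 'n) cotangent_chart \<Rightarrow> (real ^ 'n) \<times> (real ^ 'n)) \<Rightarrow>
        (('m, 'n) cotangent_chart \<Rightarrow> (real ^ 'n) \<times> (real ^ 'n)) \<Rightarrow> real"
    and J :: "('m, 'n) cotangent \<Rightarrow>
        (('m, 'n) cotangent_chart \<Rightarrow> (real ^ 'n) \<times> (real ^ 'n)) \<Rightarrow>
        (('m, 'n) cotangent_chart \<Rightarrow> (real ^ 'n) \<times> (real ^ 'n))"
  assumes "cartan_space A K"
    and "smooth_halfline v"
    and "\<alpha> > 0" and "\<beta> > 0"
    and "\<And>u. u \<in> slit_cotangent_bundle A \<Longrightarrow> \<alpha> + 2 * tau (K u) * v (tau (K u)) > 0"
    and "bilinear_field (slit_atlas A) G"
    and "metric_given_by A K v \<alpha> \<beta> G"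
    and "endomorphism_field (slit_atlas A) J"
    and "complex_structure_given_by A K v \<alpha> \<beta> J"
  shows "almost_kaehlerian (slit_atlas A) G J"
proof -
  interpret cartan_almost_hermitian A K v \<alpha> \<beta> G J
    by unfold_locales (use assms in auto)
  show ?thesis
    by (rule almost_kaehlerian)
qed

end
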